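(* There exists a countable, $\omega$-categorical structure $M$ with the property that if $H \leq \mathrm{Aut}(M)$ is extremely amenable, then $H$ has infinitely many orbits on $M^2$. In particular, there is no $\omega$-categorical expansion of $M$ whose automorphism group is extremely amenable.
   Context: For a countable first-order structure $M$, $\mathrm{Aut}(M)$ carries the topology of pointwise convergence (a subgroup of the symmetric group on the domain of $M$), and subgroups carry the subspace topology. For a topological group $G$, a $G$-flow is a non-empty compact Hausdorff space on which $G$ acts continuously; $G$ is extremely amenable if every $G$-flow has a $G$-fixed point. An expansion of $M$ is a structure with the same domain in a larger first-order language whose reduct to the language of $M$ is $M$. *)

theory Defs
  imports "HOL-Analysis.Analysis" "HOL-Algebra.Group_Action"
begin

section \<open>First-order logic\<close>

text \<open>A symbol is a name together with its arity; constants are function symbols of arity 0.\<close>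

record 's language =
  funs :: "('s \<times> nat) set"
  rels :: "('s \<times> nat) set"

definition countable_language :: "'s language \<Rightarrow> bool" where
  "countable_language L \<longleftrightarrow> countable (funs L) \<and> countable (rels L)"

definition sublanguage :: "'s language \<Rightarrow> 's language \<Rightarrow> bool" where
  "sublanguage L L' \<longleftrightarrow> funs L \<subseteq> funs L' \<and> rels L \<subseteq> rels L'"

datatype 's fo_term = Var nat | App "'s \<times> nat" "'s fo_term list"

datatype 's fo_form =
    FEq "'s fo_term" "'s fo_term"
  | FRel "'s \<times> nat" "'s fo_term list"
  | FNeg "'s fo_form"
  | FConj "'s fo_form" "'s fo_form"
  | FEx nat "'s fo_form"

primrec wf_term :: "'s language \<Rightarrow> 's fo_term \<Rightarrow> bool" where
  "wf_term L (Var n) \<longleftrightarrow> True"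
| "wf_term L (App f ts) \<longleftrightarrow> f \<in> funs L \<and> length ts = snd f \<and> list_all (wf_term L) ts"

primrec wf_form :: "'s language \<Rightarrow> 's fo_form \<Rightarrow> bool" where
  "wf_form L (FEq s t) \<longleftrightarrow> wf_term L s \<and> wf_term L t"
| "wf_form L (FRel r ts) \<longleftrightarrow> r \<in> rels L \<and> length ts = snd r \<and> list_all (wf_term L) ts"
| "wf_form L (FNeg p) \<longleftrightarrow> wf_form L p"
| "wf_form L (FConj p q) \<longleftrightarrow> wf_form L p \<and> wf_form L q"
| "wf_form L (FEx n p) \<longleftrightarrow> wf_form L p"

primrec term_vars :: "'s fo_term \<Rightarrow> nat set" where
  "term_vars (Var n) = {n}"
| "term_vars (App f ts) = \<Union> (set (map term_vars ts))"

primrec free_vars :: "'s fo_form \<Rightarrow> nat set" where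
  "free_vars (FEq s t) = term_vars s \<union> term_vars t"
| "free_vars (FRel r ts) = \<Union> (set (map term_vars ts))"
| "free_vars (FNeg p) = free_vars p"
| "free_vars (FConj p q) = free_vars p \<union> free_vars q"
| "free_vars (FEx n p) = free_vars p - {n}"

definition sentence :: "'s language \<Rightarrow> 's fo_form \<Rightarrow> bool" where
  "sentence L p \<longleftrightarrow> wf_form L p \<and> free_vars p = {}"

record ('s, 'a) interp =
  Dom :: "'a set"
  fun_of :: "'s \<times> nat \<Rightarrow> 'a list \<Rightarrow> 'a"
  rel_of :: "'s \<times> nat \<Rightarrow> 'a list \<Rightarrow> bool"

definition tuples :: "nat \<Rightarrow> 'a set \<Rightarrow> 'a list set" where
  "tuples n A = {xs. length xs = n \<and> set xs \<subseteq> A}"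

text \<open>Values of \<open>fun_of\<close> and \<open>rel_of\<close> at symbols outside the language or at lists that are
  not tuples of the right length over the domain carry no meaning.\<close>

definition fo_structure :: "'s language \<Rightarrow> ('s, 'a) interp \<Rightarrow> bool" where
  "fo_structure L M \<longleftrightarrow>
     Dom M \<noteq> {} \<and> (\<forall>f\<in>funs L. \<forall>xs\<in>tuples (snd f) (Dom M). fun_of M f xs \<in> Dom M)"

primrec term_val :: "('s, 'a) interp \<Rightarrow> (nat \<Rightarrow> 'a) \<Rightarrow> 's fo_term \<Rightarrow> 'a" where
  "term_val M v (Var n) = v n"
| "term_val M v (App f ts) = fun_of M f (map (term_val M v) ts)"

primrec sat :: "('s, 'a) interp \<Rightarrow> (nat \<Rightarrow> 'a) \<Rightarrow> 's fo_form \<Rightarrow> bool" where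
  "sat M v (FEq s t) \<longleftrightarrow> term_val M v s = term_val M v t"
| "sat M v (FRel r ts) \<longleftrightarrow> rel_of M r (map (term_val M v) ts)"
| "sat M v (FNeg p) \<longleftrightarrow> \<not> sat M v p"
| "sat M v (FConj p q) \<longleftrightarrow> sat M v p \<and> sat M v q"
| "sat M v (FEx n p) \<longleftrightarrow> (\<exists>a\<in>Dom M. sat M (v(n := a)) p)"

definition holds :: "('s, 'a) interp \<Rightarrow> 's fo_form \<Rightarrow> bool" where
  "holds M p \<longleftrightarrow> (\<forall>v. range v \<subseteq> Dom M \<longrightarrow> sat M v p)"

definition theory_of :: "'s language \<Rightarrow> ('s, 'a) interp \<Rightarrow> 's fo_form set" where
  "theory_of L M = {p. sentence L p \<and> holds M p}"

definition model_of :: "'s language \<Rightarrow> 's fo_form set \<Rightarrow> ('s, 'a) interp \<Rightarrow> bool" where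
  "model_of L T M \<longleftrightarrow> fo_structure L M \<and> (\<forall>p\<in>T. holds M p)"

definition isomorphism ::
    "'s language \<Rightarrow> ('s, 'a) interp \<Rightarrow> ('s, 'b) interp \<Rightarrow> ('a \<Rightarrow> 'b) \<Rightarrow> bool" where
  "isomorphism L M N h \<longleftrightarrow>
     bij_betw h (Dom M) (Dom N) \<and>
     (\<forall>f\<in>funs L. \<forall>xs\<in>tuples (snd f) (Dom M). h (fun_of M f xs) = fun_of N f (map h xs)) \<and>
     (\<forall>r\<in>rels L. \<forall>xs\<in>tuples (snd r) (Dom M). rel_of M r xs \<longleftrightarrow> rel_of N r (map h xs))"

text \<open>Every countable structure is isomorphic to one whose domain is a set of natural numbers,
  so it suffices to let the competing models \<open>N\<close> range over those. The notion is meant for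
  countable languages, which have to be assumed separately: in the uncountable language of all
  relations and functions on a countable set, the full structure is the only countable model of its
  theory although its automorphism group is trivial.\<close>

definition omega_categorical :: "'s language \<Rightarrow> ('s, 'a) interp \<Rightarrow> bool" where
  "omega_categorical L M \<longleftrightarrow>
     fo_structure L M \<and> countable (Dom M) \<and> infinite (Dom M) \<and>
     (\<forall>N :: ('s, nat) interp.
        model_of L (theory_of L M) N \<and> infinite (Dom N) \<longrightarrow> (\<exists>h. isomorphism L M N h))"

definition expansion ::
    "'s language \<Rightarrow> ('s, 'a) interp \<Rightarrow> 's language \<Rightarrow> ('s, 'a) interp \<Rightarrow> bool" where
  "expansion L M L' M' \<longleftrightarrow>
     sublanguage L L' \<and> fo_structure L' M' \<and> Dom M' = Dom M \<and>
     (\<forall>f\<in>funs L. \<forall>xs\<in>tuples (snd f) (Dom M). fun_of M' f xs = fun_of M f xs) \<and>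
     (\<forall>r\<in>rels L. \<forall>xs\<in>tuples (snd r) (Dom M). rel_of M' r xs \<longleftrightarrow> rel_of M r xs)"

section \<open>Automorphism groups with the topology of pointwise convergence\<close>

text \<open>As in \<open>BijGroup\<close>, permutations of a domain are extensional functions, which are exactly
  the points of the product topology.\<close>

definition Aut :: "'s language \<Rightarrow> ('s, 'a) interp \<Rightarrow> ('a \<Rightarrow> 'a) set" where
  "Aut L M = {h \<in> Bij (Dom M). isomorphism L M M h}"

definition perm_group :: "'a set \<Rightarrow> ('a \<Rightarrow> 'a) set \<Rightarrow> ('a \<Rightarrow> 'a) monoid" where
  "perm_group S H = BijGroup S \<lparr>carrier := H\<rparr>"

definition pointwise_topology :: "'a set \<Rightarrow> ('a \<Rightarrow> 'a) set \<Rightarrow> ('a \<Rightarrow> 'a) topology" where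
  "pointwise_topology S H =
     subtopology (product_topology (\<lambda>_. discrete_topology S) S) H"

definition orbits_on_pairs :: "'a set \<Rightarrow> ('a \<Rightarrow> 'a) set \<Rightarrow> ('a \<times> 'a) set set" where
  "orbits_on_pairs S H =
     orbits (perm_group S H) (S \<times> S) (\<lambda>h. \<lambda>p\<in>S \<times> S. (h (fst p), h (snd p)))"

lemma subgroup_Aut:
  assumes M: "fo_structure L M"
  shows "subgroup (Aut L M) (BijGroup (Dom M))"
proof -
  let ?S = "Dom M"
  interpret group "BijGroup ?S" by (rule group_BijGroup)
  have tup: "map g xs \<in> tuples n ?S" if "xs \<in> tuples n ?S" "g \<in> Bij ?S" for g xs n
    using that Bij_imp_funcset[of g ?S] by (auto simp: tuples_def)
  have closed: "fun_of M f xs \<in> ?S" if "f \<in> funs L" "xs \<in> tuples (snd f) ?S" for f xs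
    using M that by (auto simp: fo_structure_def)
  have comp_map: "map (compose ?S g h) xs = map g (map h xs)"
    if "xs \<in> tuples n ?S" for g h xs n
    using that by (auto simp: tuples_def compose_def)
  have id_map: "map (\<lambda>x\<in>?S. x) xs = xs" if "xs \<in> tuples n ?S" for xs n
    using that by (auto simp: tuples_def intro!: map_idI)
  show ?thesis
  proof (rule subgroupI)
    show "Aut L M \<subseteq> carrier (BijGroup ?S)" by (auto simp: Aut_def BijGroup_def)
    have "(\<lambda>x\<in>?S. x) \<in> Aut L M"
      using id_Bij[of ?S] closed id_map by (auto simp: Aut_def isomorphism_def Bij_def)
    then show "Aut L M \<noteq> {}" by blast
  next
    fix g assume g: "g \<in> Aut L M"
    let ?k = "\<lambda>x\<in>?S. inv_into ?S g x"
    from g have gB: "g \<in> Bij ?S" and gi: "isomorphism L M M g" by (auto simp: Aut_def)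
    have kB: "?k \<in> Bij ?S" by (rule restrict_inv_into_Bij[OF gB])
    have surj: "g ` ?S = ?S" and inj: "inj_on g ?S" using gB by (auto simp: Bij_def bij_betw_def)
    have gk: "map g (map ?k xs) = xs" if "xs \<in> tuples n ?S" for xs n
      using that surj by (auto simp: tuples_def subset_iff f_inv_into_f intro!: map_idI)
    have "isomorphism L M M ?k"
      unfolding isomorphism_def
    proof (intro conjI ballI)
      show "bij_betw ?k ?S ?S" using kB by (auto simp: Bij_def)
    next
      fix f xs assume f: "f \<in> funs L" and xs: "xs \<in> tuples (snd f) ?S"
      have ys: "map ?k xs \<in> tuples (snd f) ?S" by (rule tup[OF xs kB])
      have "g (fun_of M f (map ?k xs)) = fun_of M f xs"
        using gi f ys gk[OF xs] by (metis isomorphism_def)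
      then show "?k (fun_of M f xs) = fun_of M f (map ?k xs)"
        using closed[OF f ys] closed[OF f xs] inv_into_f_f[OF inj] by (metis restrict_apply')
    next
      fix r xs assume r: "r \<in> rels L" and xs: "xs \<in> tuples (snd r) ?S"
      show "rel_of M r xs \<longleftrightarrow> rel_of M r (map ?k xs)"
        using gi r tup[OF xs kB] gk[OF xs] by (metis isomorphism_def)
    qed
    moreover have "inv\<^bsub>BijGroup ?S\<^esub> g = ?k" by (rule inv_BijGroup[OF gB])
    ultimately show "inv\<^bsub>BijGroup ?S\<^esub> g \<in> Aut L M" using kB by (simp add: Aut_def)
  next
    fix g h assume g: "g \<in> Aut L M" and h: "h \<in> Aut L M"
    from g have gB: "g \<in> Bij ?S" and gi: "isomorphism L M M g" by (auto simp: Aut_def)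
    from h have hB: "h \<in> Bij ?S" and hi: "isomorphism L M M h" by (auto simp: Aut_def)
    have cB: "compose ?S g h \<in> Bij ?S" by (rule compose_Bij[OF gB hB])
    have "isomorphism L M M (compose ?S g h)"
      unfolding isomorphism_def
    proof (intro conjI ballI)
      show "bij_betw (compose ?S g h) ?S ?S" using cB by (auto simp: Bij_def)
    next
      fix f xs assume f: "f \<in> funs L" and xs: "xs \<in> tuples (snd f) ?S"
      have "compose ?S g h (fun_of M f xs) = g (h (fun_of M f xs))"
        using closed[OF f xs] by (simp add: compose_def)
      also have "\<dots> = fun_of M f (map g (map h xs))"
        using gi hi f xs tup[OF xs hB] by (metis isomorphism_def)
      finally show "compose ?S g h (fun_of M f xs) = fun_of M f (map (compose ?S g h) xs)"
        by (simp only: comp_map[OF xs])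
    next
      fix r xs assume r: "r \<in> rels L" and xs: "xs \<in> tuples (snd r) ?S"
      show "rel_of M r xs \<longleftrightarrow> rel_of M r (map (compose ?S g h) xs)"
        using gi hi r xs tup[OF xs hB] comp_map[OF xs] by (metis isomorphism_def)
    qed
    with cB show "g \<otimes>\<^bsub>BijGroup ?S\<^esub> h \<in> Aut L M"
      using gB hB by (simp add: Aut_def BijGroup_def)
  qed
qed

section \<open>Flows and extreme amenability\<close>

definition flow ::
    "('g, 'm) monoid_scheme \<Rightarrow> 'g topology \<Rightarrow> 'x topology \<Rightarrow> ('g \<Rightarrow> 'x \<Rightarrow> 'x) \<Rightarrow> bool" where
  "flow G T X \<phi> \<longleftrightarrow>
     topspace X \<noteq> {} \<and> compact_space X \<and> Hausdorff_space X \<and>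
     group_action G (topspace X) \<phi> \<and>
     continuous_map (prod_topology T X) X (\<lambda>(g, x). \<phi> g x)"

text \<open>HOL cannot quantify over all types inside a definition, so the flows are taken on subsets of
  the fixed type \<open>nat set set\<close>, of cardinality \<open>2^(2^\<aleph>\<^sub>0)\<close>. For a separable group, in particular for
  every group of permutations of a countable set, this is no restriction: every flow contains the
  closure of an orbit as a subflow, this subflow is a compact Hausdorff space with a countable
  dense subset and hence has at most \<open>2^(2^\<aleph>\<^sub>0)\<close> points, and a fixed point of the subflow is a
  fixed point of the flow.\<close>

definition extremely_amenable :: "('g, 'm) monoid_scheme \<Rightarrow> 'g topology \<Rightarrow> bool" where
  "extremely_amenable G T \<longleftrightarrow>
     (\<forall>(X :: nat set set topology) \<phi>. flow G T X \<phi> \<longrightarrow>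
        (\<exists>x\<in>topspace X. \<forall>g\<in>carrier G. \<phi> g x = x))"

text \<open>The supply of names is uncountable so that every countable language leaves enough unused
  names: each of its countable extensions is, up to renaming the new symbols, a language over
  the same names.\<close>

type_synonym name = real

end

theory Submission
  imports Defs "HOL-Library.Diagonal_Subsequence"
begin

text \<open>The structure is a countably infinite vector space over the field with two elements, namely
  \<open>nat\<close> under bitwise exclusive or, together with relations derived from a sequence of generic
  functions \<open>f\<^sub>0, f\<^sub>1, \<dots>\<close> from the space to \<open>{0, 1}\<close>. The functions themselves are hidden: only the
  parities of \<open>f\<^sub>n\<close> over the affine cubes \<open>a, x\<^sub>1, \<dots>, x\<^sub>n\<close> of dimension \<open>n\<close> are visible. This is the same
  as knowing \<open>f\<^sub>n\<close> up to polynomial functions of degree less than \<open>n\<close>.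

  \<^emph>\<open>The structure is omega-categorical.\<close> On a finite subspace of dimension less than \<open>n\<close> every cube of
  dimension \<open>n\<close> is degenerate and has parity 0 (\<open>cube_vanishes\<close>). Hence a tuple of length \<open>k\<close> is
  subject to finitely many of the relations only, although there are infinitely many in total. A finite
  partial isomorphism that respects the visible parities extends to any further point
  (\<open>partial_iso_extend\<close>): the amount by which \<open>f\<^sub>n\<close> changes along the partial isomorphism has vanishing
  cubes, a linear projection carries this defect to the larger subspace without creating new cubes, and
  genericity supplies an image point at which \<open>f\<^sub>n\<close> takes the values so prescribed. Therefore there are
  finitely many types of tuples of each length, and this makes the structure omega-categorical
  (\<open>omega_categorical_if_finitely_many_types\<close>).

  \<^emph>\<open>Extremely amenable groups have infinitely many orbits.\<close> The functions with the same \<open>n\<close>-dimensional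
  parities as \<open>f\<^sub>n\<close> form a closed subset of the Cantor space that is invariant under all
  automorphisms. It is a flow, so an extremely amenable group \<open>H\<close> of automorphisms fixes some function
  \<open>g\<^sub>n\<close> in it. For \<open>n < m\<close> the functions \<open>g\<^sub>n\<close> and \<open>g\<^sub>m\<close> are different: parities in dimension \<open>n\<close>
  determine those in dimension \<open>m\<close>, so \<open>g\<^sub>n = g\<^sub>m\<close> would give \<open>f\<^sub>n\<close> and \<open>f\<^sub>m\<close> the same parities in
  dimension \<open>m\<close>, against genericity. Infinitely many different \<open>H\<close>-invariant functions to \<open>{0, 1}\<close> cannot exist when \<open>H\<close> has
  finitely many orbits on points, and points are pairs on the diagonal.

  \<^emph>\<open>Expansions.\<close> The automorphism group of an expansion \<open>M'\<close> is a group of automorphisms of the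
  structure. If it is extremely amenable, it has infinitely many orbits on pairs, and then \<open>M'\<close> is not
  omega-categorical by the theorem of Engeler, Ryll-Nardzewski and Svenonius
  (\<open>finitely_many_orbits_if_omega_categorical\<close>). The latter is proved as follows. Limits of sequences of
  assignments yield countable models of the theory, and all of these are isomorphic to \<open>M'\<close>. Therefore
  every finitely satisfiable sequence of formulas in finitely many variables is realised; a diagonal
  argument then shows that isolated types are dense; this allows one to build a countable elementary
  submodel all of whose types are isolated, so that \<open>M'\<close> is atomic; and weak saturation leaves room
  for finitely many isolated types only. Back-and-forth turns equality of types into equality of
  orbits.\<close>

section \<open>Formulas and their assignments\<close>

abbreviation valuation :: "('s, 'a) interp \<Rightarrow> (nat \<Rightarrow> 'a) \<Rightarrow> bool" where
  "valuation M v \<equiv> range v \<subseteq> Dom M"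

lemma valuation_upd: "valuation M v \<Longrightarrow> a \<in> Dom M \<Longrightarrow> valuation M (v(n := a))"
  by (auto simp: fun_upd_def)

lemma valuation_exists: "fo_structure L M \<Longrightarrow> \<exists>v. valuation M v"
proof -
  assume "fo_structure L M"
  then obtain a where "a \<in> Dom M" by (auto simp: fo_structure_def)
  then have "valuation M (\<lambda>_. a)" by auto
  then show ?thesis by blast
qed

lemma finite_term_vars: "finite (term_vars t)"
  by (induction t) auto

lemma finite_free_vars: "finite (free_vars p)"
  by (induction p) (auto simp: finite_term_vars)

lemma term_val_cong:
  "(\<And>i. i \<in> term_vars t \<Longrightarrow> v i = w i) \<Longrightarrow> term_val M v t = term_val M w t"
proof (induction t)
  case (App f ts)
  then have "map (term_val M v) ts = map (term_val M w) ts" by auto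
  then show ?case by (simp only: term_val.simps)
qed simp

lemma sat_cong:
  "(\<And>i. i \<in> free_vars p \<Longrightarrow> v i = w i) \<Longrightarrow> sat M v p \<longleftrightarrow> sat M w p"
proof (induction p arbitrary: v w)
  case (FEq s t)
  then show ?case using term_val_cong[of s v w M] term_val_cong[of t v w M] by auto
next
  case (FRel r ts)
  then have "term_val M v t = term_val M w t" if "t \<in> set ts" for t
    using that by (intro term_val_cong) auto
  then have "map (term_val M v) ts = map (term_val M w) ts" by auto
  then show ?case by (simp only: sat.simps)
next
  case (FConj p q)
  from FConj.IH[of v w] FConj.prems show ?case by simp
next
  case (FEx n p)
  have "sat M (v(n := a)) p \<longleftrightarrow> sat M (w(n := a)) p" for a
    by (rule FEx.IH) (use FEx.prems in auto)
  then show ?case by simp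
next
  case (FNeg p)
  from FNeg.IH[of v w] FNeg.prems show ?case by simp
qed

lemma term_val_in_Dom:
  assumes "fo_structure L M" "valuation M v"
  shows "wf_term L t \<Longrightarrow> term_val M v t \<in> Dom M"
proof (induction t)
  case (App f ts)
  then have "map (term_val M v) ts \<in> tuples (snd f) (Dom M)"
    by (auto simp: tuples_def list_all_iff)
  with assms(1) App.prems show ?case by (auto simp: fo_structure_def)
qed (use assms(2) in auto)

primrec ren_term :: "(nat \<Rightarrow> nat) \<Rightarrow> 's fo_term \<Rightarrow> 's fo_term" where
  "ren_term \<sigma> (Var n) = Var (\<sigma> n)"
| "ren_term \<sigma> (App f ts) = App f (map (ren_term \<sigma>) ts)"

definition fresh :: "nat set \<Rightarrow> nat" where
  "fresh A = (SOME m. m \<notin> A)"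

lemma fresh: "finite A \<Longrightarrow> fresh A \<notin> A"
  unfolding fresh_def by (rule someI_ex) (rule ex_new_if_finite[OF infinite_UNIV_nat])

text \<open>A bound variable is replaced by one outside the image of the free variables, so that no
  capture occurs.\<close>

primrec ren :: "'s fo_form \<Rightarrow> (nat \<Rightarrow> nat) \<Rightarrow> 's fo_form" where
  "ren (FEq s t) \<sigma> = FEq (ren_term \<sigma> s) (ren_term \<sigma> t)"
| "ren (FRel r ts) \<sigma> = FRel r (map (ren_term \<sigma>) ts)"
| "ren (FNeg p) \<sigma> = FNeg (ren p \<sigma>)"
| "ren (FConj p q) \<sigma> = FConj (ren p \<sigma>) (ren q \<sigma>)"
| "ren (FEx n p) \<sigma> =
     FEx (fresh (\<sigma> ` free_vars p)) (ren p (\<sigma>(n := fresh (\<sigma> ` free_vars p))))"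

lemma wf_ren_term: "wf_term L (ren_term \<sigma> t) \<longleftrightarrow> wf_term L t"
  by (induction t) (auto simp: list_all_iff)

lemma wf_ren: "wf_form L (ren p \<sigma>) \<longleftrightarrow> wf_form L p"
  by (induction p arbitrary: \<sigma>) (auto simp: wf_ren_term list_all_iff)

lemma term_vars_ren: "term_vars (ren_term \<sigma> t) = \<sigma> ` term_vars t"
  by (induction t) auto

lemma free_vars_ren: "free_vars (ren p \<sigma>) \<subseteq> \<sigma> ` free_vars p"
proof (induction p arbitrary: \<sigma>)
  case (FEx n p)
  define m where "m = fresh (\<sigma> ` free_vars p)"
  have "free_vars (ren p (\<sigma>(n := m))) - {m} \<subseteq> (\<sigma>(n := m)) ` free_vars p - {m}"
    using FEx.IH by blast
  also have "\<dots> \<subseteq> \<sigma> ` (free_vars p - {n})" by auto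
  finally show ?case by (simp add: m_def)
next
  case (FConj p q)
  then show ?case by (simp add: image_Un) blast
qed (auto simp: term_vars_ren)

lemma term_val_ren: "term_val M v (ren_term \<sigma> t) = term_val M (v \<circ> \<sigma>) t"
proof (induction t)
  case (App f ts)
  then have "map (term_val M v \<circ> ren_term \<sigma>) ts = map (term_val M (v \<circ> \<sigma>)) ts" by (simp add: comp_def)
  then show ?case by (simp only: ren_term.simps term_val.simps map_map)
qed simp

lemma sat_ren: "sat M v (ren p \<sigma>) \<longleftrightarrow> sat M (v \<circ> \<sigma>) p"
proof (induction p arbitrary: v \<sigma>)
  case (FRel r ts)
  have "map (term_val M v \<circ> ren_term \<sigma>) ts = map (term_val M (v \<circ> \<sigma>)) ts"
    by (simp add: term_val_ren)
  then show ?case by (simp only: ren.simps sat.simps map_map)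
next
  case (FEx n p)
  define m where "m = fresh (\<sigma> ` free_vars p)"
  have m: "m \<notin> \<sigma> ` free_vars p"
    unfolding m_def by (rule fresh) (simp add: finite_free_vars)
  have "sat M (v(m := a)) (ren p (\<sigma>(n := m))) \<longleftrightarrow> sat M ((v \<circ> \<sigma>)(n := a)) p" for a
    unfolding FEx.IH by (rule sat_cong) (use m in auto)
  then show ?case by (simp add: m_def[symmetric] comp_def)
qed (auto simp: term_val_ren)

lemma sat_sentence:
  assumes "sentence L p" shows "sat M v p \<longleftrightarrow> sat M w p"
  by (rule sat_cong) (use assms in \<open>auto simp: sentence_def\<close>)

definition formulas :: "'s language \<Rightarrow> nat \<Rightarrow> 's fo_form set" where
  "formulas L n = {p. wf_form L p \<and> free_vars p \<subseteq> {..<n}}"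

lemma formulas_wf: "p \<in> formulas L n \<Longrightarrow> wf_form L p"
  by (simp add: formulas_def)

lemma formulas_mono: "p \<in> formulas L n \<Longrightarrow> n \<le> m \<Longrightarrow> p \<in> formulas L m"
  by (force simp: formulas_def)

lemma formulas_simps [simp]:
  "FNeg p \<in> formulas L n \<longleftrightarrow> p \<in> formulas L n"
  "FConj p q \<in> formulas L n \<longleftrightarrow> p \<in> formulas L n \<and> q \<in> formulas L n"
  by (auto simp: formulas_def)

lemma FEx_in_formulas: "p \<in> formulas L (Suc n) \<Longrightarrow> FEx n p \<in> formulas L n"
  by (force simp: formulas_def less_Suc_eq)

lemma formulas_0: "formulas L 0 = {p. sentence L p}"
  by (auto simp: formulas_def sentence_def)

lemma sat_cong_formulas:
  "p \<in> formulas L n \<Longrightarrow> (\<And>i. i < n \<Longrightarrow> v i = w i) \<Longrightarrow> sat M v p \<longleftrightarrow> sat M w p"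
  by (rule sat_cong) (auto simp: formulas_def)

text \<open>The quantified variables are those from \<open>n\<close> to \<open>n + k - 1\<close>, so that a formula about the tuple of the
  first \<open>n\<close> variables is obtained with no renaming.\<close>

primrec exs :: "nat \<Rightarrow> nat \<Rightarrow> 's fo_form \<Rightarrow> 's fo_form" where
  "exs n 0 p = p"
| "exs n (Suc k) p = exs n k (FEx (n + k) p)"

lemma exs_in_formulas: "p \<in> formulas L (n + k) \<Longrightarrow> exs n k p \<in> formulas L n"
  by (induction k arbitrary: p) (auto simp: FEx_in_formulas)

lemma sat_exs:
  assumes "valuation M v" "p \<in> formulas L (n + k)"
  shows "sat M v (exs n k p) \<longleftrightarrow> (\<exists>w. valuation M w \<and> (\<forall>i<n. w i = v i) \<and> sat M w p)"
  using assms
proof (induction k arbitrary: p)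
  case 0
  then have p: "p \<in> formulas L n" by simp
  show ?case
  proof
    assume "sat M v (exs n 0 p)"
    with 0 show "\<exists>w. valuation M w \<and> (\<forall>i<n. w i = v i) \<and> sat M w p" by auto
  next
    assume "\<exists>w. valuation M w \<and> (\<forall>i<n. w i = v i) \<and> sat M w p"
    then obtain w where "\<forall>i<n. w i = v i" "sat M w p" by blast
    with sat_cong_formulas[OF p, of w v M] show "sat M v (exs n 0 p)" by simp
  qed
next
  case (Suc k)
  have "FEx (n + k) p \<in> formulas L (n + k)" using Suc.prems(2) by (simp add: FEx_in_formulas)
  then have "sat M v (exs n (Suc k) p) \<longleftrightarrow>
      (\<exists>w. valuation M w \<and> (\<forall>i<n. w i = v i) \<and> sat M w (FEx (n + k) p))"
    using Suc.IH[OF Suc.prems(1)] by simp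
  also have "\<dots> \<longleftrightarrow> (\<exists>w. valuation M w \<and> (\<forall>i<n. w i = v i) \<and> sat M w p)"
  proof
    assume "\<exists>w. valuation M w \<and> (\<forall>i<n. w i = v i) \<and> sat M w (FEx (n + k) p)"
    then obtain w a where w: "valuation M w" "\<forall>i<n. w i = v i" "a \<in> Dom M"
      "sat M (w(n + k := a)) p" by auto
    then have "\<forall>i<n. (w(n + k := a)) i = v i" by simp
    with w show "\<exists>w. valuation M w \<and> (\<forall>i<n. w i = v i) \<and> sat M w p"
      by (intro exI[of _ "w(n + k := a)"] conjI valuation_upd)
  next
    assume "\<exists>w. valuation M w \<and> (\<forall>i<n. w i = v i) \<and> sat M w p"
    then obtain w where w: "valuation M w" "\<forall>i<n. w i = v i" "sat M w p" by blast
    then have "w (n + k) \<in> Dom M" "sat M (w(n + k := w (n + k))) p" by auto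
    then have "sat M w (FEx (n + k) p)" by (simp only: sat.simps) blast
    with w show "\<exists>w. valuation M w \<and> (\<forall>i<n. w i = v i) \<and> sat M w (FEx (n + k) p)" by blast
  qed
  finally show ?case .
qed

text \<open>A valid sentence. Having no free variable at all, it makes the empty conjunction a formula in zero
  variables.\<close>

definition FTrue :: "'s fo_form" where
  "FTrue = FNeg (FEx 0 (FNeg (FEq (Var 0) (Var 0))))"

definition conj_list :: "'s fo_form list \<Rightarrow> 's fo_form" where
  "conj_list ps = foldr FConj ps FTrue"

lemma sat_conj_list: "sat M v (conj_list ps) \<longleftrightarrow> (\<forall>p\<in>set ps. sat M v p)"
  by (induction ps) (auto simp: conj_list_def FTrue_def)

lemma conj_list_in_formulas: "set ps \<subseteq> formulas L n \<Longrightarrow> conj_list ps \<in> formulas L n"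
  by (induction ps) (auto simp: conj_list_def FTrue_def formulas_def)

instance fo_term :: (countable) countable by countable_datatype
instance fo_form :: (countable) countable by countable_datatype

text \<open>The supply of names may be uncountable, but countably many of them occur in the language. Replacing
  these by natural numbers embeds the formulas of the language into the countable type of all formulas
  over \<open>nat\<close>.\<close>

lemma countable_formulas:
  fixes L :: "'s language"
  assumes "countable_language L"
  shows "countable {p. wf_form L p}"
proof -
  define A where "A = fst ` (funs L \<union> rels L)"
  have A: "countable A" using assms by (simp add: A_def countable_language_def)
  have tm: "set_fo_term t \<subseteq> A" if "wf_term L t" for t
    using that
  proof (induction t)
    case (App f ts)
    then have "fst f \<in> A" by (auto simp: A_def)
    with App show ?case by (cases f) (auto simp: list_all_iff fsts.simps)
  qed simp
  have fm: "set_fo_form p \<subseteq> A" if "wf_form L p" for p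
    using that
  proof (induction p)
    case (FRel r ts)
    then have "fst r \<in> A" by (auto simp: A_def)
    with FRel tm show ?case by (cases r) (auto simp: list_all_iff fsts.simps)
  qed (auto dest: tm)
  have "p = map_fo_form (from_nat_into A) (map_fo_form (to_nat_on A) p)" if "wf_form L p" for p
  proof -
    have "map_fo_form (from_nat_into A \<circ> to_nat_on A) p = map_fo_form id p"
      by (rule fo_form.map_cong0) (use fm[OF that] A in auto)
    then show ?thesis by (simp add: fo_form.map_comp fo_form.map_id)
  qed
  then have "{p. wf_form L p} \<subseteq> range (map_fo_form (from_nat_into A))" by blast
  then show ?thesis by (rule countable_subset) simp
qed

lemma isomorphism_bij: "isomorphism L M N h \<Longrightarrow> bij_betw h (Dom M) (Dom N)"
  by (simp add: isomorphism_def)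

lemma term_val_isomorphism:
  assumes "isomorphism L M N h" "fo_structure L M" "valuation M v"
  shows "wf_term L t \<Longrightarrow> term_val N (h \<circ> v) t = h (term_val M v t)"
proof (induction t)
  case (App f ts)
  then have "map (term_val M v) ts \<in> tuples (snd f) (Dom M)"
    using term_val_in_Dom[OF assms(2,3)] by (auto simp: tuples_def list_all_iff)
  moreover have "map (term_val N (h \<circ> v)) ts = map h (map (term_val M v) ts)"
    using App by (simp add: list_all_iff comp_def)
  moreover have "f \<in> funs L" using App.prems by simp
  ultimately show ?case
    using assms(1) by (simp only: isomorphism_def term_val.simps)
qed simp

lemma sat_isomorphism:
  assumes "isomorphism L M N h" "fo_structure L M" "valuation M v" "wf_form L p"
  shows "sat N (h \<circ> v) p \<longleftrightarrow> sat M v p"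
  using assms(3,4)
proof (induction p arbitrary: v)
  case (FEq s t)
  then have wf: "wf_term L s" "wf_term L t" by simp_all
  have "inj_on h (Dom M)" using isomorphism_bij[OF assms(1)] by (simp add: bij_betw_def)
  then show ?case
    using term_val_isomorphism[OF assms(1,2) FEq.prems(1)] wf
      term_val_in_Dom[OF assms(2) FEq.prems(1)]
    by (simp only: sat.simps inj_on_eq_iff)
next
  case (FRel r ts)
  then have wf: "r \<in> rels L" "length ts = snd r" "\<And>t. t \<in> set ts \<Longrightarrow> wf_term L t"
    by (simp_all add: list_all_iff)
  have "map (term_val M v) ts \<in> tuples (snd r) (Dom M)"
    using term_val_in_Dom[OF assms(2) FRel.prems(1) wf(3)] wf(2) by (auto simp: tuples_def)
  moreover have "map (term_val N (h \<circ> v)) ts = map h (map (term_val M v) ts)"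
    using term_val_isomorphism[OF assms(1,2) FRel.prems(1) wf(3)] by (simp only: map_map o_apply cong: map_cong)
  ultimately show ?case using assms(1) wf(1) by (simp only: isomorphism_def sat.simps)
next
  case (FEx n p)
  have "sat N ((h \<circ> v)(n := h a)) p \<longleftrightarrow> sat M (v(n := a)) p" if "a \<in> Dom M" for a
  proof -
    have "wf_form L p" using FEx.prems(2) by simp
    moreover have "(h \<circ> v)(n := h a) = h \<circ> v(n := a)" by (simp only: fun_upd_comp)
    ultimately show ?thesis by (simp only: FEx.IH[OF valuation_upd[OF FEx.prems(1) that]])
  qed
  moreover have "Dom N = h ` Dom M"
    using isomorphism_bij[OF assms(1)] by (simp add: bij_betw_def)
  ultimately show ?case by (simp only: sat.simps image_iff bex_simps cong: bex_cong)
next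
  case (FNeg p)
  have "wf_form L p" using FNeg.prems(2) by simp
  with FNeg.IH[OF FNeg.prems(1)] show ?case by (simp only: sat.simps)
next
  case (FConj p q)
  have "wf_form L p" "wf_form L q" using FConj.prems(2) by simp_all
  with FConj.IH(1,2)[OF FConj.prems(1)] show ?case by (simp only: sat.simps)
qed


section \<open>Types, atomic structures and back-and-forth\<close>

text \<open>Tuples of length \<open>n\<close> are represented by the first \<open>n\<close> values of an assignment. A tuple is always
  prolonged at the position \<open>n\<close>, the variable that \<open>FEx n\<close> binds.\<close>

definition ftype :: "'s language \<Rightarrow> ('s, 'a) interp \<Rightarrow> nat \<Rightarrow> (nat \<Rightarrow> 'a) \<Rightarrow> 's fo_form set" where
  "ftype L M n v = {p \<in> formulas L n. sat M v p}"

lemma ftype_eq_iff: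
  "ftype L M n v = ftype L N n w \<longleftrightarrow> (\<forall>p\<in>formulas L n. sat M v p \<longleftrightarrow> sat N w p)"
  by (auto simp: ftype_def)

definition isolates :: "'s language \<Rightarrow> ('s, 'a) interp \<Rightarrow> nat \<Rightarrow> 's fo_form \<Rightarrow> bool" where
  "isolates L M n p \<longleftrightarrow> p \<in> formulas L n \<and> (\<exists>v. valuation M v \<and> sat M v p) \<and>
     (\<forall>v w. valuation M v \<and> valuation M w \<and> sat M v p \<and> sat M w p \<longrightarrow>
       ftype L M n v = ftype L M n w)"

definition atomic :: "'s language \<Rightarrow> ('s, 'a) interp \<Rightarrow> bool" where
  "atomic L M \<longleftrightarrow> (\<forall>n v. valuation M v \<longrightarrow> (\<exists>p. isolates L M n p \<and> sat M v p))"

text \<open>A formula isolating the type of the longer tuple in \<open>M\<close> has a witness over the corresponding tuple in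
  \<open>N\<close>. The implications from the isolating formula to all members of the type are properties of the
  shorter tuple, so they hold in \<open>N\<close> as well.\<close>

lemma atomic_forth:
  assumes "atomic L M" "valuation M v"
    and eq: "ftype L M n v = ftype L N n w" and a: "a \<in> Dom M"
  shows "\<exists>b\<in>Dom N. ftype L M (Suc n) (v(n := a)) = ftype L N (Suc n) (w(n := b))"
proof -
  have va: "valuation M (v(n := a))" using assms(2) a by (rule valuation_upd)
  with assms(1) obtain p where p: "isolates L M (Suc n) p" "sat M (v(n := a)) p"
    unfolding atomic_def by blast
  have transfer: "sat M v q \<longleftrightarrow> sat N w q" if "q \<in> formulas L n" for q
    using eq that by (simp add: ftype_eq_iff)
  have pf: "p \<in> formulas L (Suc n)" using p(1) by (simp add: isolates_def)
  have "sat M v (FEx n p)" using a p(2) by auto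
  then have "sat N w (FEx n p)" using transfer[OF FEx_in_formulas[OF pf]] by blast
  then obtain b where b: "b \<in> Dom N" "sat N (w(n := b)) p" by auto
  have pos: "sat N (w(n := b)) q" if q: "q \<in> formulas L (Suc n)" "sat M (v(n := a)) q" for q
  proof -
    have "sat M (v(n := c)) q" if "c \<in> Dom M" "sat M (v(n := c)) p" for c
    proof -
      have "ftype L M (Suc n) (v(n := a)) = ftype L M (Suc n) (v(n := c))"
        using p va that valuation_upd[OF assms(2) that(1)] unfolding isolates_def by blast
      with q show ?thesis by (simp add: ftype_eq_iff)
    qed
    then have "\<not> sat M v (FEx n (FConj p (FNeg q)))" by auto
    moreover have "FEx n (FConj p (FNeg q)) \<in> formulas L n"
      using pf q(1) by (intro FEx_in_formulas) simp
    ultimately have "\<not> sat N w (FEx n (FConj p (FNeg q)))"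
      using transfer by blast
    with b show ?thesis by auto
  qed
  have "sat M (v(n := a)) q \<longleftrightarrow> sat N (w(n := b)) q" if "q \<in> formulas L (Suc n)" for q
    using pos[OF that] pos[of "FNeg q"] that by auto
  with b(1) show ?thesis by (auto simp: ftype_eq_iff)
qed

text \<open>Two enumerations that satisfy the same formulas induce a well-defined bijection because of the
  equations between variables among these formulas.\<close>

lemma isomorphism_of_enumerations:
  assumes M: "fo_structure L M" and V: "range V = Dom M" and W: "range W = Dom N"
    and eq: "\<And>p. wf_form L p \<Longrightarrow> sat M V p \<longleftrightarrow> sat N W p"
  shows "\<exists>h. isomorphism L M N h \<and> (\<forall>i. h (V i) = W i)"
proof -
  define h where "h x = W (SOME i. V i = x)" for x
  have inj: "V i = V j \<longleftrightarrow> W i = W j" for i j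
    using eq[of "FEq (Var i) (Var j)"] by simp
  have h: "h (V i) = W i" for i
  proof -
    have "V (SOME j. V j = V i) = V i" by (rule someI) simp
    then show ?thesis using inj by (simp add: h_def)
  qed
  have tup: "\<exists>js. xs = map V js \<and> length js = n" if "xs \<in> tuples n (Dom M)" for xs n
  proof -
    from that have "set xs \<subseteq> range V" "length xs = n" using V by (auto simp: tuples_def)
    then have "xs = map V (map (inv_into UNIV V) xs)" by (auto simp: f_inv_into_f intro!: map_idI[symmetric])
    with \<open>length xs = n\<close> show ?thesis by (metis length_map)
  qed
  have "isomorphism L M N h"
    unfolding isomorphism_def
  proof (intro conjI ballI)
    have "inj_on h (Dom M)" unfolding V[symmetric] by (auto simp: inj_on_def h inj)
    moreover have "h ` Dom M = Dom N" unfolding V[symmetric] W[symmetric] by (simp add: image_image h)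
    ultimately show "bij_betw h (Dom M) (Dom N)" by (simp add: bij_betw_def)
  next
    fix f xs assume f: "f \<in> funs L" and xs: "xs \<in> tuples (snd f) (Dom M)"
    obtain js where js: "xs = map V js" "length js = snd f" using tup[OF xs] by blast
    have "fun_of M f xs \<in> Dom M" using M f xs by (simp add: fo_structure_def)
    then obtain j where j: "fun_of M f xs = V j" using V by auto
    have "sat M V (FEq (App f (map Var js)) (Var j))"
      using j js by (simp add: comp_def)
    moreover have "wf_form L (FEq (App f (map Var js)) (Var j))"
      using f js by (simp add: list_all_iff)
    ultimately have "sat N W (FEq (App f (map Var js)) (Var j))" using eq by blast
    then show "h (fun_of M f xs) = fun_of N f (map h xs)"
      using js j h by (simp add: comp_def)
  next
    fix r xs assume r: "r \<in> rels L" and xs: "xs \<in> tuples (snd r) (Dom M)"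
    obtain js where js: "xs = map V js" "length js = snd r" using tup[OF xs] by blast
    have "wf_form L (FRel r (map Var js))" using r js by (simp add: list_all_iff)
    from eq[OF this] show "rel_of M r xs \<longleftrightarrow> rel_of N r (map h xs)"
      using js h by (simp add: comp_def)
  qed
  with h show ?thesis by blast
qed

text \<open>The tuples are prolonged alternately, by the next element of an enumeration of \<open>M\<close> and by the next
  element of an enumeration of \<open>N\<close>, with equality of types as the invariant.\<close>

lemma back_and_forth:
  assumes M: "fo_structure L M" "countable (Dom M)" "atomic L M"
    and N: "fo_structure L N" "countable (Dom N)" "atomic L N"
    and v0: "valuation M v0" and w0: "valuation N w0" and eq: "ftype L M n v0 = ftype L N n w0"
  shows "\<exists>h. isomorphism L M N h \<and> (\<forall>i<n. h (v0 i) = w0 i)"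
proof -
  have neM: "Dom M \<noteq> {}" and neN: "Dom N \<noteq> {}"
    using M(1) N(1) by (simp_all add: fo_structure_def)
  define a where "a = from_nat_into (Dom M)"
  define b where "b = from_nat_into (Dom N)"
  have a: "range a = Dom M" and b: "range b = Dom N"
    unfolding a_def b_def using M(2) N(2) neM neN by (simp_all add: range_from_nat_into)
  \<comment> \<open>stage \<open>k\<close> fixes the positions below \<open>n + 2 * k\<close>; it places \<open>a k\<close> at \<open>n + 2 * k\<close> on the side of \<open>M\<close>
    and \<open>b k\<close> at the position after it on the side of \<open>N\<close>\<close>
  define P where "P k z \<longleftrightarrow> valuation M (fst z) \<and> valuation N (snd z) \<and>
     ftype L M (n + 2 * k) (fst z) = ftype L N (n + 2 * k) (snd z) \<and>
     (k = 0 \<longrightarrow> z = (v0, w0))" for k :: nat and z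
  define Q where "Q k z z' \<longleftrightarrow>
     (\<forall>i<n + 2 * k. fst z' i = fst z i \<and> snd z' i = snd z i) \<and>
     fst z' (n + 2 * k) = a k \<and> snd z' (Suc (n + 2 * k)) = b k" for k :: nat and z z'
  have "\<exists>z. \<forall>k. P k (z k) \<and> Q k (z k) (z (Suc k))"
  proof (rule dependent_nat_choice)
    show "\<exists>z. P 0 z" using v0 w0 eq by (auto simp: P_def)
  next
    fix z k assume "P k z"
    define m where "m = n + 2 * k"
    obtain v w where z: "z = (v, w)" by (cases z)
    from \<open>P k z\<close> have vw: "valuation M v" "valuation N w" "ftype L M m v = ftype L N m w"
      by (auto simp: P_def z m_def)
    have ak: "a k \<in> Dom M" and bk: "b k \<in> Dom N" using a b by auto
    obtain d where d: "d \<in> Dom N"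
      "ftype L M (Suc m) (v(m := a k)) = ftype L N (Suc m) (w(m := d))"
      using atomic_forth[OF M(3) vw(1,3) ak] by blast
    define v1 w1 where "v1 = v(m := a k)" and "w1 = w(m := d)"
    have v1: "valuation M v1" and w1: "valuation N w1"
      unfolding v1_def w1_def by (intro valuation_upd vw ak d)+
    obtain c where c: "c \<in> Dom M"
      "ftype L N (Suc (Suc m)) (w1(Suc m := b k)) = ftype L M (Suc (Suc m)) (v1(Suc m := c))"
      using atomic_forth[OF N(3) w1 _ bk, of "Suc m" M v1] d(2) by (auto simp: v1_def w1_def)
    have "P (Suc k) (v1(Suc m := c), w1(Suc m := b k))"
      using valuation_upd[OF v1 c(1)] valuation_upd[OF w1 bk] c(2) by (simp add: P_def m_def)
    moreover have "Q k z (v1(Suc m := c), w1(Suc m := b k))"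
      by (simp add: Q_def z m_def[symmetric] v1_def w1_def)
    ultimately show "\<exists>z'. P (Suc k) z' \<and> Q k z z'" by blast
  qed
  then obtain z where z: "\<And>k. P k (z k)" "\<And>k. Q k (z k) (z (Suc k))" by blast
  define V where "V i = fst (z (Suc i)) i" for i
  define W where "W i = snd (z (Suc i)) i" for i
  have stable: "fst (z (k + j)) i = fst (z k) i \<and> snd (z (k + j)) i = snd (z k) i"
    if "i < n + 2 * k" for i j k
    using that
  proof (induction j)
    case (Suc j)
    then show ?case using z(2)[of "k + j"] by (simp add: Q_def)
  qed simp
  have VW: "V i = fst (z k) i \<and> W i = snd (z k) i" if "i < n + 2 * k" for i k
    using stable[OF that, of "Suc i"] stable[of i "Suc i" k] by (simp add: V_def W_def add.commute)
  have rV: "range V = Dom M"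
  proof
    show "range V \<subseteq> Dom M" using z(1) unfolding V_def P_def by blast
    show "Dom M \<subseteq> range V"
    proof
      fix x assume "x \<in> Dom M"
      then obtain k where "x = a k" using a by blast
      then have "x = V (n + 2 * k)" using z(2)[of k] VW[of "n + 2 * k" "Suc k"] by (simp add: Q_def)
      then show "x \<in> range V" by simp
    qed
  qed
  have rW: "range W = Dom N"
  proof
    show "range W \<subseteq> Dom N" using z(1) unfolding W_def P_def by blast
    show "Dom N \<subseteq> range W"
    proof
      fix x assume "x \<in> Dom N"
      then obtain k where "x = b k" using b by blast
      then have "x = W (Suc (n + 2 * k))"
        using z(2)[of k] VW[of "Suc (n + 2 * k)" "Suc k"] by (simp add: Q_def)
      then show "x \<in> range W" by simp
    qed
  qed
  have "sat M V p \<longleftrightarrow> sat N W p" if p: "wf_form L p" for p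
  proof -
    obtain k where k: "free_vars p \<subseteq> {..<k}"
      using finite_free_vars[of p] finite_nat_iff_bounded by blast
    have pf: "p \<in> formulas L (n + 2 * k)" using p k by (force simp: formulas_def)
    have "sat M V p \<longleftrightarrow> sat M (fst (z k)) p"
      by (rule sat_cong_formulas[OF pf]) (simp add: VW)
    moreover have "sat N W p \<longleftrightarrow> sat N (snd (z k)) p"
      by (rule sat_cong_formulas[OF pf]) (simp add: VW)
    ultimately show ?thesis using z(1)[of k] pf by (simp add: P_def ftype_eq_iff)
  qed
  then obtain h where "isomorphism L M N h" "\<forall>i. h (V i) = W i"
    using isomorphism_of_enumerations[OF M(1) rV rW] by blast
  moreover have "V i = v0 i \<and> W i = w0 i" if "i < n" for i
    using VW[of i 0] z(1)[of 0] that by (simp add: P_def)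
  ultimately show ?thesis by metis
qed

section \<open>Structures with finitely many types\<close>

text \<open>The isolating formula is the conjunction of one formula against each of the finitely many other types.\<close>

lemma isolates_if_finitely_many_types:
  assumes fin: "finite {ftype L M n v |v. valuation M v}" and v: "valuation M v"
  shows "\<exists>p. isolates L M n p \<and> sat M v p"
proof -
  define T where "T = {ftype L M n v |v. valuation M v} - {ftype L M n v}"
  have "\<exists>p\<in>formulas L n. sat M v p \<and> p \<notin> t" if t: "t \<in> T" for t
  proof -
    from t obtain w where w: "t = ftype L M n w" "ftype L M n w \<noteq> ftype L M n v"
      by (auto simp: T_def)
    then obtain p where p: "p \<in> formulas L n" "sat M v p \<noteq> sat M w p"
      by (auto simp: ftype_eq_iff)
    show ?thesis
    proof (cases "sat M v p")
      case True
      with p w(1) show ?thesis by (auto simp: ftype_def)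
    next
      case False
      with p have "FNeg p \<in> formulas L n" "sat M v (FNeg p)" "FNeg p \<notin> t"
        by (auto simp: w(1) ftype_def)
      then show ?thesis by blast
    qed
  qed
  then obtain d where d: "\<And>t. t \<in> T \<Longrightarrow> d t \<in> formulas L n \<and> sat M v (d t) \<and> d t \<notin> t"
    by metis
  obtain ts where ts: "set ts = T" using finite_list[of T] fin unfolding T_def by blast
  define p where "p = conj_list (map d ts)"
  have p: "p \<in> formulas L n" unfolding p_def
    by (rule conj_list_in_formulas) (use d ts in auto)
  have vp: "sat M v p" using d ts by (simp add: p_def sat_conj_list)
  have eq: "ftype L M n w = ftype L M n v" if "valuation M w" "sat M w p" for w
  proof (rule ccontr)
    assume "ftype L M n w \<noteq> ftype L M n v"
    with that(1) have t: "ftype L M n w \<in> T" by (auto simp: T_def)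
    with that(2) have "sat M w (d (ftype L M n w))" by (simp add: p_def sat_conj_list ts)
    with d[OF t] show False by (simp add: ftype_def)
  qed
  have "isolates L M n p"
    unfolding isolates_def
  proof (intro conjI allI impI)
    show "p \<in> formulas L n" by (rule p)
    show "\<exists>v. valuation M v \<and> sat M v p" using v vp by blast
    fix w w' assume "valuation M w \<and> valuation M w' \<and> sat M w p \<and> sat M w' p"
    then show "ftype L M n w = ftype L M n w'" using eq[of w] eq[of w'] by simp
  qed
  with vp show ?thesis by blast
qed

lemma model_of_theory_sentence:
  assumes M: "fo_structure L M" and N: "model_of L (theory_of L M) N"
    and v: "valuation M v" and w: "valuation N w" and p: "p \<in> formulas L 0"
  shows "sat N w p \<longleftrightarrow> sat M v p"
proof -
  have s: "sat N w q" if "sat M v q" "sentence L q" for q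
  proof -
    have "holds M q" using that sat_sentence[OF that(2), of M] unfolding holds_def by blast
    then have "holds N q" using N that by (simp add: model_of_def theory_of_def)
    with w show ?thesis by (simp add: holds_def)
  qed
  have "sentence L p" "sentence L (FNeg p)" using p by (auto simp: formulas_0 sentence_def)
  with s[of p] s[of "FNeg p"] show ?thesis by auto
qed

lemma satisfiable_elementary:
  assumes M: "fo_structure L M" and N: "model_of L (theory_of L M) N" and q: "q \<in> formulas L n"
  shows "(\<exists>w. valuation N w \<and> sat N w q) \<longleftrightarrow> (\<exists>v. valuation M v \<and> sat M v q)"
proof -
  have N': "fo_structure L N" using N by (simp add: model_of_def)
  obtain v0 where v0: "valuation M v0" using valuation_exists[OF M] by blast
  obtain w0 where w0: "valuation N w0" using valuation_exists[OF N'] by blast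
  have q': "q \<in> formulas L (0 + n)" using q by simp
  show ?thesis
    using model_of_theory_sentence[OF M N v0 w0 exs_in_formulas[OF q']]
      sat_exs[OF v0 q'] sat_exs[OF w0 q'] by simp
qed

text \<open>Failure of isolation is witnessed by the satisfiability of \<open>p \<and> q\<close> and of \<open>p \<and> \<not> q\<close> for a single \<open>q\<close>.\<close>

lemma isolates_elementary:
  assumes M: "fo_structure L M" and N: "model_of L (theory_of L M) N" and p: "isolates L M n p"
  shows "isolates L N n p"
proof -
  note ex = satisfiable_elementary[OF M N]
  have pf: "p \<in> formulas L n" using p by (simp add: isolates_def)
  have "sat N w q" if w: "valuation N w" "sat N w p" and w': "valuation N w'" "sat N w' p"
    and q: "q \<in> formulas L n" "sat N w' q" for w w' q
  proof (rule ccontr)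
    assume "\<not> sat N w q"
    then have "\<exists>w. valuation N w \<and> sat N w (FConj p (FNeg q))"
      and "\<exists>w. valuation N w \<and> sat N w (FConj p q)"
      using w w' q by auto
    then obtain v v' where v: "valuation M v" "sat M v p" "\<not> sat M v q"
      and v': "valuation M v'" "sat M v' p" "sat M v' q"
      using ex[of "FConj p (FNeg q)" n] ex[of "FConj p q" n] pf q(1) by auto
    then have "ftype L M n v = ftype L M n v'" using p unfolding isolates_def by blast
    with v v' q(1) show False by (simp add: ftype_eq_iff)
  qed
  then have "ftype L N n w = ftype L N n w'"
    if "valuation N w" "valuation N w'" "sat N w p" "sat N w' p" for w w'
    using that unfolding ftype_eq_iff by blast
  moreover have "\<exists>w. valuation N w \<and> sat N w p"
    using ex[OF pf] p unfolding isolates_def by blast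
  ultimately show ?thesis using pf unfolding isolates_def by blast
qed

text \<open>The disjunction of formulas isolating the finitely many types is valid in the structure, hence in every
  model of its theory. So these models are atomic, and back-and-forth applies.\<close>

theorem omega_categorical_if_finitely_many_types:
  assumes M: "fo_structure L M" "countable (Dom M)" "infinite (Dom M)"
    and fin: "\<And>n. finite {ftype L M n v |v. valuation M v}"
  shows "omega_categorical L M"
  unfolding omega_categorical_def
proof (intro conjI allI impI)
  fix N :: "('a, nat) interp"
  assume "model_of L (theory_of L M) N \<and> infinite (Dom N)"
  then have N: "model_of L (theory_of L M) N" and N': "fo_structure L N"
    by (simp_all add: model_of_def)
  obtain v0 where v0: "valuation M v0" using valuation_exists[OF M(1)] by blast
  obtain w0 where w0: "valuation N w0" using valuation_exists[OF N'] by blast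
  have aM: "atomic L M"
    unfolding atomic_def using isolates_if_finitely_many_types[OF fin] by blast
  have "\<exists>p. isolates L N n p \<and> sat N w p" if w: "valuation N w" for n w
  proof -
    define T where "T = {ftype L M n v |v. valuation M v}"
    have "\<exists>p. isolates L M n p \<and> p \<in> t" if "t \<in> T" for t
    proof -
      from that obtain v where v: "t = ftype L M n v" "valuation M v" by (auto simp: T_def)
      from isolates_if_finitely_many_types[OF fin v(2)] obtain p where
        "isolates L M n p" "sat M v p" by blast
      then show ?thesis by (auto simp: v(1) ftype_def isolates_def)
    qed
    then have "\<exists>d. \<forall>t\<in>T. isolates L M n (d t) \<and> d t \<in> t" by (intro bchoice) blast
    then obtain d where d: "\<And>t. t \<in> T \<Longrightarrow> isolates L M n (d t) \<and> d t \<in> t" by blast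
    obtain ts where ts: "set ts = T" using finite_list[OF fin[of n]] unfolding T_def by blast
    define p where "p = conj_list (map (\<lambda>t. FNeg (d t)) ts)"
    have p: "p \<in> formulas L n" unfolding p_def
      by (rule conj_list_in_formulas) (use d ts in \<open>auto simp: isolates_def\<close>)
    have "\<not> sat M v p" if "valuation M v" for v
    proof -
      have "ftype L M n v \<in> T" using that by (auto simp: T_def)
      with d have "sat M v (d (ftype L M n v))" by (auto simp: ftype_def)
      with \<open>ftype L M n v \<in> T\<close> ts show ?thesis by (auto simp: p_def sat_conj_list)
    qed
    then have "\<not> sat N w p" using satisfiable_elementary[OF M(1) N p] w by blast
    then obtain t where "t \<in> T" "sat N w (d t)" using ts by (auto simp: p_def sat_conj_list)
    then show ?thesis using isolates_elementary[OF M(1) N] d by blast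
  qed
  then have aN: "atomic L N" by (simp add: atomic_def)
  have "ftype L M 0 v0 = ftype L N 0 w0"
    using model_of_theory_sentence[OF M(1) N v0 w0] by (simp add: ftype_eq_iff)
  then show "\<exists>h. isomorphism L M N h"
    using back_and_forth[OF M(1,2) aM N' _ aN v0 w0] by blast
qed (use M in auto)


section \<open>Limits of sequences of assignments\<close>

text \<open>The variables become the elements of the new structure, and a formula holds of them when it holds along
  the filter. This is the theorem of Los, with the hypothesis \<open>dec\<close> in the role of an ultrafilter and
  \<open>wit\<close> in the role of the Henkin witnesses that make the quantifier step work. A constant sequence yields
  the elementary substructure on the values of the assignment.\<close>

lemma limit_structure:
  fixes M :: "('s, 'a) interp" and u :: "nat \<Rightarrow> nat \<Rightarrow> 'a"
  assumes M: "fo_structure L M" and u: "\<And>m. valuation M (u m)" and F: "F \<noteq> bot"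
    and dec: "\<And>p. wf_form L p \<Longrightarrow>
      (\<forall>\<^sub>F m in F. sat M (u m) p) \<or> (\<forall>\<^sub>F m in F. \<not> sat M (u m) p)"
    and wit: "\<And>k p. wf_form L p \<Longrightarrow> free_vars p \<subseteq> {..k} \<Longrightarrow>
      \<exists>n. \<forall>m. sat M (u m) (FEx k p) \<longrightarrow> sat M ((u m)(k := u m n)) p"
  shows "\<exists>(N :: ('s, nat) interp) e. fo_structure L N \<and> range e = Dom N \<and>
    (\<forall>p s. wf_form L p \<longrightarrow> (sat N (e \<circ> s) p \<longleftrightarrow> (\<forall>\<^sub>F m in F. sat M (u m \<circ> s) p)))"
proof -
  \<comment> \<open>elements are represented by the least variable of their class, so that the domain is a set of
    natural numbers\<close>
  define e where "e i = (LEAST j. \<forall>\<^sub>F m in F. u m i = u m j)" for i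
  have e: "\<forall>\<^sub>F m in F. u m i = u m (e i)" for i
    unfolding e_def by (rule LeastI[of _ i]) simp
  have e_eq: "e i = e j \<longleftrightarrow> (\<forall>\<^sub>F m in F. u m i = u m j)" for i j
  proof
    assume eq: "e i = e j"
    show "\<forall>\<^sub>F m in F. u m i = u m j" using e[of i] e[of j] by eventually_elim (simp add: eq)
  next
    assume *: "\<forall>\<^sub>F m in F. u m i = u m j"
    have "(\<forall>\<^sub>F m in F. u m i = u m k) \<longleftrightarrow> (\<forall>\<^sub>F m in F. u m j = u m k)" for k
      by (rule eventually_cong[OF *]) simp
    then show "e i = e j" by (simp add: e_def)
  qed
  have map_e: "\<forall>\<^sub>F m in F. map (u m) (map e js) = map (u m) js" for js
  proof (induction js)
    case (Cons j js)
    with e[of j] show ?case by eventually_elim simp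
  qed simp
  define N :: "('s, nat) interp" where "N = \<lparr>Dom = range e,
    fun_of = (\<lambda>f xs. e (SOME i. \<forall>\<^sub>F m in F. u m i = fun_of M f (map (u m) xs))),
    rel_of = (\<lambda>r xs. \<forall>\<^sub>F m in F. rel_of M r (map (u m) xs))\<rparr>"
  \<comment> \<open>the values of functions are among the elements: the formula \<open>f(x) = y\<close> has a witness by \<open>wit\<close>\<close>
  have fun_wit: "\<exists>i. \<forall>m. u m i = fun_of M f (map (u m) js)"
    if f: "f \<in> funs L" "length js = snd f" for f js
  proof -
    obtain k where k: "set js \<subseteq> {..<k}" using finite_nat_iff_bounded[of "set js"] by auto
    define p where "p = FEq (App f (map Var js)) (Var k)"
    have p: "wf_form L p" "free_vars p \<subseteq> {..k}"
      using f k by (auto simp: p_def list_all_iff)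
    from wit[OF p] obtain i where
      i: "\<And>m. sat M (u m) (FEx k p) \<Longrightarrow> sat M ((u m)(k := u m i)) p" by blast
    have val: "term_val M (v(k := a)) (App f (map Var js)) = fun_of M f (map v js)" for v a
    proof -
      have "map (term_val M (v(k := a))) (map Var js) = map v js" using k by auto
      then show ?thesis by (simp only: term_val.simps)
    qed
    have "fun_of M f (map (u m) js) = u m i" for m
    proof -
      have "map (u m) js \<in> tuples (snd f) (Dom M)" using u[of m] f by (auto simp: tuples_def)
      then have "fun_of M f (map (u m) js) \<in> Dom M" using M f by (simp add: fo_structure_def)
      then have "sat M (u m) (FEx k p)" using val by (simp add: p_def del: term_val.simps(2))
      from i[OF this] show ?thesis using val by (simp add: p_def del: term_val.simps(2))
    qed
    then show ?thesis by metis
  qed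
  have term_lim: "\<exists>i. term_val N (e \<circ> s) t = e i \<and> (\<forall>\<^sub>F m in F. u m i = term_val M (u m \<circ> s) t)"
    if "wf_term L t" for t s
    using that
  proof (induction t)
    case (Var n)
    have "term_val N (e \<circ> s) (Var n) = e (s n) \<and>
      (\<forall>\<^sub>F m in F. u m (s n) = term_val M (u m \<circ> s) (Var n))" by simp
    then show ?case by blast
  next
    case (App f ts)
    then have "\<forall>t\<in>set ts. \<exists>i. term_val N (e \<circ> s) t = e i \<and>
        (\<forall>\<^sub>F m in F. u m i = term_val M (u m \<circ> s) t)"
      by (simp add: list_all_iff comp_def)
    from bchoice[OF this] obtain g where g: "\<And>t. t \<in> set ts \<Longrightarrow> term_val N (e \<circ> s) t = e (g t)"
      "\<And>t. t \<in> set ts \<Longrightarrow> \<forall>\<^sub>F m in F. u m (g t) = term_val M (u m \<circ> s) t" by blast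
    have f: "f \<in> funs L" "length ts = snd f" using App.prems by simp_all
    have mapN: "map (term_val N (e \<circ> s)) ts = map e (map g ts)" using g(1) by simp
    have "\<forall>\<^sub>F m in F. \<forall>t\<in>set ts. u m (g t) = term_val M (u m \<circ> s) t"
      using g(2) by (simp add: eventually_ball_finite_distrib)
    with map_e[of "map g ts"]
    have mapM: "\<forall>\<^sub>F m in F. map (u m) (map e (map g ts)) = map (term_val M (u m \<circ> s)) ts"
      by eventually_elim simp
    define i where "i = (SOME i. \<forall>\<^sub>F m in F. u m i = fun_of M f (map (u m) (map e (map g ts))))"
    have "\<forall>\<^sub>F m in F. u m i = fun_of M f (map (u m) (map e (map g ts)))"
      unfolding i_def
    proof (rule someI_ex)
      have "length (map e (map g ts)) = snd f" using f(2) by simp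
      from fun_wit[OF f(1) this] obtain j
        where "\<And>m. u m j = fun_of M f (map (u m) (map e (map g ts)))" by blast
      then show "\<exists>i. \<forall>\<^sub>F m in F. u m i = fun_of M f (map (u m) (map e (map g ts)))"
        by (intro exI[of _ j] always_eventually allI)
    qed
    with mapM have "\<forall>\<^sub>F m in F. u m i = term_val M (u m \<circ> s) (App f ts)"
      by eventually_elim (simp only: term_val.simps)
    moreover have "term_val N (e \<circ> s) (App f ts) = e i"
      unfolding term_val.simps mapN by (simp add: N_def i_def)
    ultimately show ?case by blast
  qed
  have "sat N (e \<circ> s) p \<longleftrightarrow> (\<forall>\<^sub>F m in F. sat M (u m \<circ> s) p)" if "wf_form L p" for p s
    using that
  proof (induction p arbitrary: s)
    case (FEq t1 t2)
    then have wf: "wf_term L t1" "wf_term L t2" by simp_all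
    obtain i where i: "term_val N (e \<circ> s) t1 = e i" "\<forall>\<^sub>F m in F. u m i = term_val M (u m \<circ> s) t1"
      using term_lim[OF wf(1)] by blast
    obtain j where j: "term_val N (e \<circ> s) t2 = e j" "\<forall>\<^sub>F m in F. u m j = term_val M (u m \<circ> s) t2"
      using term_lim[OF wf(2)] by blast
    have "\<forall>\<^sub>F m in F. u m i = u m j \<longleftrightarrow> sat M (u m \<circ> s) (FEq t1 t2)"
      using i(2) j(2) by eventually_elim (simp only: sat.simps)
    then have "(\<forall>\<^sub>F m in F. u m i = u m j) \<longleftrightarrow> (\<forall>\<^sub>F m in F. sat M (u m \<circ> s) (FEq t1 t2))"
      by (rule eventually_cong) simp
    then show ?case by (simp only: sat.simps i(1) j(1) e_eq)
  next
    case (FRel r ts)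
    then have "\<forall>t\<in>set ts. \<exists>i. term_val N (e \<circ> s) t = e i \<and>
        (\<forall>\<^sub>F m in F. u m i = term_val M (u m \<circ> s) t)"
      using term_lim by (auto simp: list_all_iff)
    from bchoice[OF this] obtain g where g: "\<And>t. t \<in> set ts \<Longrightarrow> term_val N (e \<circ> s) t = e (g t)"
      "\<And>t. t \<in> set ts \<Longrightarrow> \<forall>\<^sub>F m in F. u m (g t) = term_val M (u m \<circ> s) t" by blast
    have mapN: "map (term_val N (e \<circ> s)) ts = map e (map g ts)" using g(1) by simp
    have "\<forall>\<^sub>F m in F. \<forall>t\<in>set ts. u m (g t) = term_val M (u m \<circ> s) t"
      using g(2) by (simp add: eventually_ball_finite_distrib)
    with map_e[of "map g ts"]
    have "\<forall>\<^sub>F m in F. map (u m) (map e (map g ts)) = map (term_val M (u m \<circ> s)) ts"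
      by eventually_elim simp
    then have "(\<forall>\<^sub>F m in F. rel_of M r (map (u m) (map e (map g ts)))) \<longleftrightarrow>
        (\<forall>\<^sub>F m in F. rel_of M r (map (term_val M (u m \<circ> s)) ts))"
      by (rule eventually_cong) (simp only:)
    then show ?case unfolding sat.simps mapN by (simp add: N_def)
  next
    case (FNeg p)
    then have wf: "wf_form L p" by simp
    have dec': "(\<forall>\<^sub>F m in F. sat M (u m \<circ> s) p) \<or> (\<forall>\<^sub>F m in F. \<not> sat M (u m \<circ> s) p)"
      using dec[of "ren p s"] wf by (simp add: wf_ren sat_ren)
    have "\<not> ((\<forall>\<^sub>F m in F. sat M (u m \<circ> s) p) \<and> (\<forall>\<^sub>F m in F. \<not> sat M (u m \<circ> s) p))"
    proof
      assume "(\<forall>\<^sub>F m in F. sat M (u m \<circ> s) p) \<and> (\<forall>\<^sub>F m in F. \<not> sat M (u m \<circ> s) p)"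
      then have "\<forall>\<^sub>F m in F. sat M (u m \<circ> s) p \<and> \<not> sat M (u m \<circ> s) p"
        by (simp only: eventually_conj_iff)
      then show False using F by simp
    qed
    with dec' show ?case using FNeg.IH[OF wf, of s] by (simp only: sat.simps) blast
  next
    case (FConj p q)
    then have wf: "wf_form L p" "wf_form L q" by simp_all
    show ?case using FConj.IH(1)[OF wf(1), of s] FConj.IH(2)[OF wf(2), of s]
      by (simp only: sat.simps eventually_conj_iff)
  next
    case (FEx n p)
    then have wf: "wf_form L p" by simp
    have upd: "(f \<circ> s)(n := f j) = f \<circ> s(n := j)" for f :: "nat \<Rightarrow> 'c" and j
      by (simp only: fun_upd_comp)
    have "sat N (e \<circ> s) (FEx n p) \<longleftrightarrow> (\<exists>j. sat N ((e \<circ> s)(n := e j)) p)"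
      by (simp only: sat.simps) (simp add: N_def)
    also have "\<dots> \<longleftrightarrow> (\<exists>j. \<forall>\<^sub>F m in F. sat M ((u m \<circ> s)(n := u m j)) p)"
      by (simp only: upd FEx.IH[OF wf])
    also have "\<dots> \<longleftrightarrow> (\<forall>\<^sub>F m in F. sat M (u m \<circ> s) (FEx n p))"
    proof
      assume "\<exists>j. \<forall>\<^sub>F m in F. sat M ((u m \<circ> s)(n := u m j)) p"
      then obtain j where "\<forall>\<^sub>F m in F. sat M ((u m \<circ> s)(n := u m j)) p" by blast
      then show "\<forall>\<^sub>F m in F. sat M (u m \<circ> s) (FEx n p)"
      proof eventually_elim
        case (elim m)
        moreover have "u m j \<in> Dom M" using u[of m] by blast
        ultimately show ?case by (simp only: sat.simps) blast
      qed
    next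
      assume ev: "\<forall>\<^sub>F m in F. sat M (u m \<circ> s) (FEx n p)"
      obtain k where k: "s ` free_vars p \<subseteq> {..<k}"
        using finite_nat_iff_bounded[of "s ` free_vars p"] finite_free_vars by blast
      \<comment> \<open>the renaming moves the bound variable above all others, to the form required by \<open>wit\<close>\<close>
      define q where "q = ren p (s(n := k))"
      have q: "sat M (v(k := a)) q \<longleftrightarrow> sat M ((v \<circ> s)(n := a)) p" for v a
        unfolding q_def sat_ren by (rule sat_cong) (use k in auto)
      have "free_vars q \<subseteq> (s(n := k)) ` free_vars p" unfolding q_def by (rule free_vars_ren)
      also have "\<dots> \<subseteq> {..k}" using k by (auto simp: less_imp_le)
      finally obtain j where
        j: "\<And>m. sat M (u m) (FEx k q) \<Longrightarrow> sat M ((u m)(k := u m j)) q"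
        using wit[of q k] wf by (auto simp: q_def wf_ren)
      from ev have "\<forall>\<^sub>F m in F. sat M ((u m \<circ> s)(n := u m j)) p"
      proof eventually_elim
        case (elim m)
        then have "sat M (u m) (FEx k q)" by (simp only: sat.simps q)
        from j[OF this] show ?case by (simp only: q)
      qed
      then show "\<exists>j. \<forall>\<^sub>F m in F. sat M ((u m \<circ> s)(n := u m j)) p" by blast
    qed
    finally show ?case .
  qed
  moreover have "fo_structure L N" by (auto simp: N_def fo_structure_def)
  moreover have "range e = Dom N" by (simp add: N_def)
  ultimately show ?thesis by blast
qed

section \<open>Consequences of omega-categoricity\<close>

text \<open>Every task, to find a witness for the last variable \<open>k\<close> of a formula \<open>p\<close>, returns infinitely often.
  Thus it comes up after the values of the variables below \<open>k\<close> have been chosen.\<close>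

lemma task_enumeration:
  fixes L :: "'s language"
  assumes "countable_language L"
  shows "\<exists>E :: nat \<Rightarrow> nat \<times> 's fo_form.
    (\<forall>i. wf_form L (snd (E i)) \<and> free_vars (snd (E i)) \<subseteq> {..fst (E i)}) \<and>
    (\<forall>k p m. wf_form L p \<and> free_vars p \<subseteq> {..k} \<longrightarrow> (\<exists>i\<ge>m. E i = (k, p)))"
proof -
  define T :: "(nat \<times> 's fo_form) set"
    where "T = {(k, p). wf_form L p \<and> free_vars p \<subseteq> {..k}}"
  have "T \<subseteq> UNIV \<times> {p. wf_form L p}" by (auto simp: T_def)
  then have cT: "countable T"
    by (rule countable_subset) (simp add: countable_formulas[OF assms])
  have "(0, FTrue) \<in> T" by (simp add: T_def FTrue_def)
  then have T: "range (from_nat_into T) = T" using cT by (intro range_from_nat_into) auto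
  define E where "E i = from_nat_into T (fst (prod_decode i))" for i
  have "E i \<in> T" for i unfolding E_def using T by blast
  moreover have "\<exists>i\<ge>m. E i = t" if "t \<in> T" for t m
  proof -
    from that T obtain j where "t = from_nat_into T j" by blast
    then have "E (prod_encode (j, m)) = t" by (simp add: E_def)
    with le_prod_encode_2 show ?thesis by blast
  qed
  ultimately show ?thesis by (intro exI[of _ E]) (auto simp: T_def split_beta)
qed

text \<open>The values from \<open>n\<close> on are chosen one after the other. The value at \<open>i\<close> serves as witness for the task
  \<open>E i\<close> and preserves \<open>I\<close>, a property of the values chosen before.\<close>

lemma witnessing_assignment:
  fixes M :: "('s, 'a) interp" and E :: "nat \<Rightarrow> nat \<times> 's fo_form"
  assumes v: "valuation M v" and I: "I n v"
    and E: "\<And>i. free_vars (snd (E i)) \<subseteq> {..fst (E i)}"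
    and cong: "\<And>i w w'. I i w \<Longrightarrow> (\<And>j. j < i \<Longrightarrow> w' j = w j) \<Longrightarrow> I i w'"
    and step: "\<And>i w. i \<ge> n \<Longrightarrow> valuation M w \<Longrightarrow> I i w \<Longrightarrow>
      \<exists>a\<in>Dom M. I (Suc i) (w(i := a)) \<and>
        (fst (E i) < i \<longrightarrow> sat M w (FEx (fst (E i)) (snd (E i))) \<longrightarrow>
          sat M (w(fst (E i) := a)) (snd (E i)))"
  shows "\<exists>u. valuation M u \<and> (\<forall>i<n. u i = v i) \<and> (\<forall>i\<ge>n. I i u) \<and>
    (\<forall>i\<ge>n. fst (E i) < i \<longrightarrow> sat M u (FEx (fst (E i)) (snd (E i))) \<longrightarrow>
      sat M (u(fst (E i) := u i)) (snd (E i)))"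
proof -
  define P where "P k w \<longleftrightarrow> valuation M w \<and> I (n + k) w \<and> (k = 0 \<longrightarrow> w = v)" for k w
  define Q where "Q k w w' \<longleftrightarrow> (\<forall>j<n + k. w' j = w j) \<and>
    (fst (E (n + k)) < n + k \<longrightarrow> sat M w (FEx (fst (E (n + k))) (snd (E (n + k)))) \<longrightarrow>
      sat M (w(fst (E (n + k)) := w' (n + k))) (snd (E (n + k))))" for k w w'
  have "\<exists>z. \<forall>k. P k (z k) \<and> Q k (z k) (z (Suc k))"
  proof (rule dependent_nat_choice)
    show "\<exists>w. P 0 w" using v I by (simp add: P_def)
  next
    fix w k assume "P k w"
    then obtain a where a: "a \<in> Dom M" "I (Suc (n + k)) (w(n + k := a))"
      "fst (E (n + k)) < n + k \<longrightarrow> sat M w (FEx (fst (E (n + k))) (snd (E (n + k)))) \<longrightarrow>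
          sat M (w(fst (E (n + k)) := a)) (snd (E (n + k)))"
      and w: "valuation M w"
      using step[of "n + k" w] unfolding P_def by auto
    have "P (Suc k) (w(n + k := a))"
      using valuation_upd[OF w a(1)] a(2) by (simp add: P_def)
    moreover have "Q k w (w(n + k := a))" using a(3) by (simp add: Q_def)
    ultimately show "\<exists>w'. P (Suc k) w' \<and> Q k w w'" by blast
  qed
  then obtain z where z: "\<And>k. P k (z k)" "\<And>k. Q k (z k) (z (Suc k))" by blast
  define u where "u i = z (Suc i) i" for i
  have stable: "z (k + j) i = z k i" if "i < n + k" for i j k
    using that
  proof (induction j)
    case (Suc j)
    then show ?case using z(2)[of "k + j"] by (simp add: Q_def)
  qed simp
  have u: "u i = z k i" if "i < n + k" for i k
    using stable[OF that, of "Suc i"] stable[of i "Suc i" k] by (simp add: u_def add.commute)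
  have "valuation M u" using z(1) unfolding u_def P_def by blast
  moreover have "u i = v i" if "i < n" for i using u[of i 0] z(1)[of 0] that by (simp add: P_def)
  moreover have "I i u" if i: "i \<ge> n" for i
  proof -
    obtain k where k: "i = n + k" using i by (auto simp: le_iff_add)
    have "I i (z k)" using z(1)[of k] k by (simp add: P_def)
    then show ?thesis by (rule cong) (simp add: u[of _ k] k)
  qed
  moreover have "sat M (u(fst (E i) := u i)) (snd (E i))"
    if i: "i \<ge> n" "fst (E i) < i" "sat M u (FEx (fst (E i)) (snd (E i)))" for i
  proof -
    obtain k where k: "i = n + k" using i(1) by (auto simp: le_iff_add)
    have eq: "sat M (u(fst (E i) := a)) (snd (E i)) \<longleftrightarrow>
        sat M ((z k)(fst (E i) := a)) (snd (E i))" for a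
      by (rule sat_cong) (use E[of i] i(2) u[of _ k] k in auto)
    have "sat M (z k) (FEx (fst (E i)) (snd (E i)))" using i(3) eq by simp
    then have "sat M ((z k)(fst (E i) := z (Suc k) i)) (snd (E i))"
      using z(2)[of k] i(2) by (simp add: Q_def k)
    then show ?thesis using eq u[of i "Suc k"] k by simp
  qed
  ultimately show ?thesis by blast
qed

text \<open>For each \<open>n\<close> the theory says that no \<open>n\<close> elements exhaust the domain.\<close>

lemma infinite_elementary:
  assumes M: "fo_structure L M" "infinite (Dom M)" and N: "model_of L (theory_of L M) N"
  shows "infinite (Dom N)"
proof
  assume fin: "finite (Dom N)"
  have N': "fo_structure L N" using N by (simp add: model_of_def)
  obtain w0 where w0: "valuation N w0" using valuation_exists[OF N'] by blast
  obtain xs where xs: "set xs = Dom N" using finite_list[OF fin] by blast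
  define n where "n = length xs"
  define w where "w i = (if i < n then xs ! i else w0 i)" for i
  have w: "valuation N w" using xs w0 by (auto simp: w_def n_def)
  define p :: "'a fo_form"
    where "p = conj_list (map (\<lambda>i. FNeg (FEq (Var i) (Var n))) [0..<n])"
  have p: "p \<in> formulas L (Suc n)" unfolding p_def
    by (rule conj_list_in_formulas) (auto simp: formulas_def)
  have "sat M v (FEx n p)" if "valuation M v" for v
  proof -
    obtain a where "a \<in> Dom M" "a \<notin> v ` {..<n}"
      using M(2) by (meson finite_imageI finite_lessThan infinite_super subsetI)
    then have "a \<in> Dom M" "sat M (v(n := a)) p" by (auto simp: p_def sat_conj_list)
    then show ?thesis by (simp only: sat.simps) blast
  qed
  then have no: "\<not> (\<exists>v. valuation M v \<and> sat M v (FNeg (FEx n p)))" by auto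
  have "FNeg (FEx n p) \<in> formulas L n" using p by (simp add: FEx_in_formulas)
  from satisfiable_elementary[OF M(1) N this] no have "\<not> sat N w (FNeg (FEx n p))"
    using w by blast
  then obtain b where b: "b \<in> Dom N" "sat N (w(n := b)) p" by auto
  from b(1) have "b \<in> set xs" using xs by simp
  then obtain i where i: "i < n" "b = xs ! i" by (auto simp: in_set_conv_nth n_def)
  then have "(w(n := b)) i = (w(n := b)) n" by (simp add: w_def)
  with b(2) i(1) show False unfolding p_def sat_conj_list by auto
qed

lemma subsequence_deciding:
  assumes "countable A"
  shows "\<exists>r :: nat \<Rightarrow> nat. strict_mono r \<and>
    (\<forall>a\<in>A. (\<forall>\<^sub>F m in sequentially. S (r m) a) \<or> (\<forall>\<^sub>F m in sequentially. \<not> S (r m) a))"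
proof (cases "A = {}")
  case True
  then show ?thesis using strict_mono_id by auto
next
  case False
  define a where "a = from_nat_into A"
  have a: "range a = A" unfolding a_def using assms False by (simp add: range_from_nat_into)
  define D where "D i s \<longleftrightarrow> (\<forall>\<^sub>F m in sequentially. S (s m) (a i)) \<or>
    (\<forall>\<^sub>F m in sequentially. \<not> S (s m) (a i))" for i and s :: "nat \<Rightarrow> nat"
  interpret subseqs D
  proof
    fix i and s :: "nat \<Rightarrow> nat" assume s: "strict_mono s"
    define B where "B = {m. S (s m) (a i)}"
    have mem: "m \<in> B \<longleftrightarrow> S (s m) (a i)" for m by (simp add: B_def)
    consider "infinite B" | "infinite (- B)"
      using finite_compl infinite_UNIV_nat by (metis Compl_UNIV_eq finite_Un sup_compl_top)
    then show "\<exists>r'. strict_mono r' \<and> D i (s \<circ> r')"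
    proof cases
      case 1
      then have "S (s (enumerate B m)) (a i)" for m using enumerate_in_set[OF 1, of m] mem by blast
      then have "D i (s \<circ> enumerate B)" by (simp add: D_def)
      with strict_mono_enumerate[OF 1] show ?thesis by blast
    next
      case 2
      then have "\<not> S (s (enumerate (- B) m)) (a i)" for m
        using enumerate_in_set[OF 2, of m] mem by blast
      then have "D i (s \<circ> enumerate (- B))" by (simp add: D_def)
      with strict_mono_enumerate[OF 2] show ?thesis by blast
    qed
  qed
  have "D i diagseq" for i
  proof -
    have "D i (diagseq \<circ> (+) (Suc i))"
    proof (rule diagseq_holds)
      fix r s :: "nat \<Rightarrow> nat" and j assume r: "strict_mono r" and "D j s"
      moreover have "filterlim r sequentially sequentially" by (rule filterlim_subseq[OF r])
      ultimately show "D j (s \<circ> r)" unfolding D_def o_def filterlim_iff by blast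
    qed
    moreover have "D i (s \<circ> (+) (Suc i)) \<Longrightarrow> D i s" for s
      using eventually_sequentially_seg[of "\<lambda>m. S (s m) (a i)" "Suc i"]
        eventually_sequentially_seg[of "\<lambda>m. \<not> S (s m) (a i)" "Suc i"]
      by (simp add: D_def add.commute)
    ultimately show ?thesis by blast
  qed
  then have "\<forall>x\<in>A. (\<forall>\<^sub>F m in sequentially. S (diagseq m) x) \<or>
      (\<forall>\<^sub>F m in sequentially. \<not> S (diagseq m) x)"
    unfolding a[symmetric] D_def by blast
  with subseq_diagseq show ?thesis by blast
qed

text \<open>The limit is a countable model of the theory, hence a copy of \<open>M\<close>. So the limit type is realised in
  \<open>M\<close> itself, by an enumeration of the whole domain.\<close>

lemma limit_structure_isomorphic:
  fixes M :: "('s, 'a) interp" and u :: "nat \<Rightarrow> nat \<Rightarrow> 'a"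
  assumes oc: "omega_categorical L M" and u: "\<And>m. valuation M (u m)" and F: "F \<noteq> bot"
    and dec: "\<And>p. wf_form L p \<Longrightarrow>
      (\<forall>\<^sub>F m in F. sat M (u m) p) \<or> (\<forall>\<^sub>F m in F. \<not> sat M (u m) p)"
    and wit: "\<And>k p. wf_form L p \<Longrightarrow> free_vars p \<subseteq> {..k} \<Longrightarrow>
      \<exists>n. \<forall>m. sat M (u m) (FEx k p) \<longrightarrow> sat M ((u m)(k := u m n)) p"
  shows "\<exists>c. range c = Dom M \<and>
    (\<forall>p s. wf_form L p \<longrightarrow> (sat M (c \<circ> s) p \<longleftrightarrow> (\<forall>\<^sub>F m in F. sat M (u m \<circ> s) p)))"
proof -
  have M: "fo_structure L M" "infinite (Dom M)" using oc by (auto simp: omega_categorical_def)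
  obtain N :: "('s, nat) interp" and e where N: "fo_structure L N" "range e = Dom N"
    and sat_e: "\<And>p s. wf_form L p \<Longrightarrow> sat N (e \<circ> s) p \<longleftrightarrow> (\<forall>\<^sub>F m in F. sat M (u m \<circ> s) p)"
    using limit_structure[OF M(1) u F dec wit] by blast
  have "model_of L (theory_of L M) N"
    unfolding model_of_def
  proof (intro conjI ballI N(1))
    fix p assume "p \<in> theory_of L M"
    then have p: "sentence L p" "holds M p" by (auto simp: theory_of_def)
    then have "\<forall>\<^sub>F m in F. sat M (u m \<circ> id) p" using u by (auto simp: holds_def)
    then have "sat N e p" using sat_e[of p id] p(1) by (simp add: sentence_def)
    then show "holds N p" using sat_sentence[OF p(1)] unfolding holds_def by blast
  qed
  moreover from infinite_elementary[OF M this] have "infinite (Dom N)" .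
  ultimately obtain h where h: "isomorphism L M N h"
    using oc unfolding omega_categorical_def by blast
  have hb: "bij_betw h (Dom M) (Dom N)" using h by (rule isomorphism_bij)
  define c where "c = inv_into (Dom M) h \<circ> e"
  have bij: "bij_betw (inv_into (Dom M) h) (Dom N) (Dom M)" by (rule bij_betw_inv_into[OF hb])
  have c: "range c = Dom M"
    unfolding c_def image_comp[symmetric] N(2) using bij by (simp add: bij_betw_def)
  have he: "h \<circ> c = e"
  proof
    fix i
    have "e i \<in> h ` Dom M" using N(2) hb by (auto simp: bij_betw_def)
    then show "(h \<circ> c) i = e i" by (simp add: c_def f_inv_into_f)
  qed
  have "sat M (c \<circ> s) p \<longleftrightarrow> (\<forall>\<^sub>F m in F. sat M (u m \<circ> s) p)" if p: "wf_form L p" for p s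
  proof -
    have "valuation M (c \<circ> s)" using c by auto
    from sat_isomorphism[OF h M(1) this p] sat_e[OF p, of s] show ?thesis
      by (simp only: comp_assoc[symmetric] he)
  qed
  with c show ?thesis by blast
qed

text \<open>For each \<open>k\<close> a tuple satisfying the first \<open>k\<close> formulas is prolonged by Henkin witnesses. A subsequence
  of these assignments decides all formulas, and its limit realises all \<open>\<Phi> i\<close>.\<close>

lemma weakly_saturated_if_omega_categorical:
  fixes M :: "('s, 'a) interp"
  assumes L: "countable_language L" and oc: "omega_categorical L M"
    and \<Phi>: "\<And>i. \<Phi> i \<in> formulas L n"
    and fs: "\<And>k. \<exists>v. valuation M v \<and> (\<forall>i\<le>k. sat M v (\<Phi> i))"
  shows "\<exists>v. valuation M v \<and> (\<forall>i::nat. sat M v (\<Phi> i))"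
proof -
  obtain E :: "nat \<Rightarrow> nat \<times> 's fo_form" where
    E: "\<And>i. wf_form L (snd (E i))" "\<And>i. free_vars (snd (E i)) \<subseteq> {..fst (E i)}"
      "\<And>k p m. wf_form L p \<Longrightarrow> free_vars p \<subseteq> {..k} \<Longrightarrow> \<exists>i\<ge>m. E i = (k, p)"
    using task_enumeration[OF L] by blast
  have "\<exists>u. valuation M u \<and> (\<forall>i\<le>k. sat M u (\<Phi> i)) \<and>
    (\<forall>i\<ge>n. fst (E i) < i \<longrightarrow> sat M u (FEx (fst (E i)) (snd (E i))) \<longrightarrow>
      sat M (u(fst (E i) := u i)) (snd (E i)))" for k
  proof -
    obtain v where v: "valuation M v" "\<forall>i\<le>k. sat M v (\<Phi> i)" using fs by blast
    have "\<exists>a\<in>Dom M. True \<and> (fst (E i) < i \<longrightarrow> sat M w (FEx (fst (E i)) (snd (E i))) \<longrightarrow>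
          sat M (w(fst (E i) := a)) (snd (E i)))" if "valuation M w" for i w
    proof (cases "sat M w (FEx (fst (E i)) (snd (E i)))")
      case True
      then show ?thesis by auto
    next
      case False
      moreover have "w 0 \<in> Dom M" using that by blast
      ultimately show ?thesis by blast
    qed
    from witnessing_assignment[where I = "\<lambda>_ _. True" and n = n and E = E and M = M, OF v(1) _ E(2) _ this]
    obtain u where u: "valuation M u" "\<forall>i<n. u i = v i"
      "\<forall>i\<ge>n. fst (E i) < i \<longrightarrow> sat M u (FEx (fst (E i)) (snd (E i))) \<longrightarrow>
      sat M (u(fst (E i) := u i)) (snd (E i))" by blast
    have "sat M u (\<Phi> i)" if "i \<le> k" for i
      using sat_cong_formulas[OF \<Phi>, of u v M i] u(2) v(2) that by simp
    with u show ?thesis by blast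
  qed
  then obtain u where u: "\<And>k. valuation M (u k)" "\<And>k i. i \<le> k \<Longrightarrow> sat M (u k) (\<Phi> i)"
    "\<And>k i. i \<ge> n \<Longrightarrow> fst (E i) < i \<Longrightarrow> sat M (u k) (FEx (fst (E i)) (snd (E i))) \<Longrightarrow>
      sat M ((u k)(fst (E i) := u k i)) (snd (E i))"
    by metis
  obtain r :: "nat \<Rightarrow> nat" where r: "strict_mono r" and
    dec: "\<forall>p\<in>{p. wf_form L p}. (\<forall>\<^sub>F m in sequentially. sat M (u (r m)) p) \<or>
      (\<forall>\<^sub>F m in sequentially. \<not> sat M (u (r m)) p)"
    using subsequence_deciding[OF countable_formulas[OF L], of "\<lambda>m p. sat M (u m) p"] by blast
  have wit: "\<exists>i. \<forall>m. sat M (u (r m)) (FEx k p) \<longrightarrow> sat M ((u (r m))(k := u (r m) i)) p"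
    if p: "wf_form L p" "free_vars p \<subseteq> {..k}" for k p
  proof -
    obtain i where i: "i \<ge> max n (Suc k)" "E i = (k, p)" using E(3)[OF p] by blast
    then have "sat M ((u (r m))(k := u (r m) i)) p" if "sat M (u (r m)) (FEx k p)" for m
      using u(3)[of i "r m"] that by simp
    then show ?thesis by blast
  qed
  obtain c where c: "range c = Dom M" "\<And>p s. wf_form L p \<Longrightarrow>
      sat M (c \<circ> s) p \<longleftrightarrow> (\<forall>\<^sub>F m in sequentially. sat M (u (r m) \<circ> s) p)"
    using limit_structure_isomorphic[OF oc, of "\<lambda>m. u (r m)" sequentially] u(1) dec wit by auto
  have "sat M c (\<Phi> i)" for i
  proof -
    have "\<forall>\<^sub>F m in sequentially. sat M (u (r m)) (\<Phi> i)"
      using eventually_ge_at_top[of i]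
    proof eventually_elim
      case (elim m)
      with seq_suble[OF r, of m] show ?case by (intro u(2)) simp
    qed
    then show ?thesis using c(2)[of "\<Phi> i" id] formulas_wf[OF \<Phi>] by simp
  qed
  with c(1) show ?thesis by (intro exI[of _ c]) simp
qed

text \<open>If no formula below \<open>p\<close> isolated a type, then every such formula could be split. Splitting repeatedly,
  each time away from the next tuple of an enumeration of all tuples, produces a finitely
  satisfiable sequence without a realisation, against weak saturation.\<close>

lemma isolated_types_dense:
  fixes M :: "('s, 'a) interp"
  assumes L: "countable_language L" and oc: "omega_categorical L M"
    and p: "p \<in> formulas L n" "valuation M v" "sat M v p"
  shows "\<exists>q. isolates L M n q \<and> (\<forall>w. valuation M w \<longrightarrow> sat M w q \<longrightarrow> sat M w p)"
proof (rule ccontr)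
  assume none: "\<not> ?thesis"
  have cD: "countable (Dom M)" using oc by (simp add: omega_categorical_def)
  \<comment> \<open>representatives of all \<open>n\<close>-tuples, made into assignments by the values of \<open>v\<close> beyond \<open>n\<close>\<close>
  define C where "C = (\<lambda>xs i. if i < n then xs ! i else v i) ` {xs. set xs \<subseteq> Dom M \<and> length xs = n}"
  have "countable {xs. set xs \<subseteq> Dom M \<and> length xs = n}"
    by (rule countable_subset[OF _ countable_lists[OF cD]]) (auto simp: lists_eq_set)
  then have cC: "countable C" by (simp add: C_def)
  have C: "(\<lambda>i. if i < n then w i else v i) \<in> C" if "valuation M w" for w
    unfolding C_def by (rule image_eqI[of _ _ "map w [0..<n]"]) (use that in auto)
  have Cval: "valuation M w" if "w \<in> C" for w
  proof -
    from that obtain xs where xs: "set xs \<subseteq> Dom M" "length xs = n"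
      and w: "w = (\<lambda>i. if i < n then xs ! i else v i)" by (auto simp: C_def)
    have "w i \<in> Dom M" for i
    proof (cases "i < n")
      case True
      with xs show ?thesis using nth_mem[of i xs] by (auto simp: w)
    next
      case False
      have "v i \<in> Dom M" using p(2) by blast
      with False show ?thesis by (simp add: w)
    qed
    then show ?thesis by blast
  qed
  have "C \<noteq> {}" using C p(2) by blast
  define c where "c = from_nat_into C"
  have c: "range c = C" unfolding c_def using cC \<open>C \<noteq> {}\<close> by (simp add: range_from_nat_into)
  define B where "B q \<longleftrightarrow> q \<in> formulas L n \<and> (\<exists>w. valuation M w \<and> sat M w q) \<and>
    (\<forall>w. valuation M w \<longrightarrow> sat M w q \<longrightarrow> sat M w p)" for q
  have split: "\<exists>q'. B q' \<and> (\<forall>w. sat M w q' \<longrightarrow> sat M w q) \<and> \<not> sat M x q'" if q: "B q" for q x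
  proof -
    have "\<not> isolates L M n q" using none q unfolding B_def by blast
    then obtain w w' where w: "valuation M w" "valuation M w'" "sat M w q" "sat M w' q"
      "ftype L M n w \<noteq> ftype L M n w'"
      using q unfolding isolates_def B_def by blast
    then obtain d where d: "d \<in> formulas L n" "sat M w d \<noteq> sat M w' d"
      by (auto simp: ftype_eq_iff)
    obtain y y' where y: "valuation M y" "valuation M y'" "sat M y q" "sat M y' q"
      "sat M y d" "\<not> sat M y' d"
      using w d(2) by (cases "sat M w d") auto
    show ?thesis
    proof (cases "sat M x d")
      case True
      have "B (FConj q (FNeg d))" using q d(1) y unfolding B_def by auto
      with True show ?thesis by (intro exI[of _ "FConj q (FNeg d)"]) auto
    next
      case False
      have "B (FConj q d)" using q d(1) y unfolding B_def by auto
      with False show ?thesis by (intro exI[of _ "FConj q d"]) auto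
    qed
  qed
  have "\<exists>q. \<forall>k. B (q k) \<and>
    ((\<forall>w. sat M w (q (Suc k)) \<longrightarrow> sat M w (q k)) \<and> \<not> sat M (c k) (q (Suc k)))"
  proof (rule dependent_nat_choice)
    show "\<exists>q. B q" using p by (auto simp: B_def)
  qed (use split in blast)
  then obtain q where q: "\<And>k. B (q k)" "\<And>k w. sat M w (q (Suc k)) \<Longrightarrow> sat M w (q k)"
    "\<And>k. \<not> sat M (c k) (q (Suc k))" by blast
  have mono: "sat M w (q k) \<Longrightarrow> i \<le> k \<Longrightarrow> sat M w (q i)" for w i k
  proof (induction k)
    case (Suc k)
    then show ?case using q(2) by (cases "i = Suc k") auto
  qed simp
  have qf: "q i \<in> formulas L n" for i using q(1) by (simp add: B_def)
  have "\<exists>v. valuation M v \<and> (\<forall>i. sat M v (q i))"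
  proof (rule weakly_saturated_if_omega_categorical[OF L oc qf])
    fix k show "\<exists>v. valuation M v \<and> (\<forall>i\<le>k. sat M v (q i))"
      using q(1)[of k] mono[of _ k] unfolding B_def by blast
  qed
  then obtain w where w: "valuation M w" "\<And>i. sat M w (q i)" by blast
  from C[OF w(1)] obtain k where k: "(\<lambda>i. if i < n then w i else v i) = c k"
    unfolding c[symmetric] by (rule imageE)
  have "sat M (c k) (q (Suc k)) \<longleftrightarrow> sat M w (q (Suc k))"
    by (rule sat_cong_formulas[OF qf]) (simp add: k[symmetric])
  with w(2) q(3) show False by blast
qed

text \<open>The formula says of \<open>y\<close> that there is a tuple \<open>x\<close> with \<open>p(x)\<close> and \<open>y\<^sub>i = x\<^bsub>s i\<^esub>\<close>. It determines the type
  of \<open>y\<close>, since the formulas true of \<open>y\<close> are renamings of formulas true of \<open>x\<close>.\<close>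

lemma isolates_subtuple:
  assumes p: "isolates L M k p" "sat M u p" and u: "valuation M u" and s: "\<And>i. i < n \<Longrightarrow> s i < k"
  shows "\<exists>q. isolates L M n q \<and> sat M (u \<circ> s) q"
proof -
  have pf: "p \<in> formulas L k" using p by (simp add: isolates_def)
  define r where "r = conj_list (ren p (\<lambda>i. n + i) # map (\<lambda>i. FEq (Var i) (Var (n + s i))) [0..<n])"
  define q where "q = exs n k r"
  have "ren p (\<lambda>i. n + i) \<in> formulas L (n + k)"
  proof -
    have "free_vars (ren p (\<lambda>i. n + i)) \<subseteq> (\<lambda>i. n + i) ` free_vars p" by (rule free_vars_ren)
    also have "\<dots> \<subseteq> {..<n + k}" using pf by (auto simp: formulas_def)
    finally show ?thesis using pf by (simp add: formulas_def wf_ren)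
  qed
  then have r: "r \<in> formulas L (n + k)" unfolding r_def
    by (intro conj_list_in_formulas) (use s in \<open>auto simp: formulas_def\<close>)
  then have q: "q \<in> formulas L n" unfolding q_def by (rule exs_in_formulas)
  have sat_r: "sat M w r \<longleftrightarrow> sat M (\<lambda>i. w (n + i)) p \<and> (\<forall>i<n. w i = w (n + s i))" for w
    by (auto simp: r_def sat_conj_list sat_ren comp_def)
  have sat_q: "\<exists>x. valuation M x \<and> sat M x p \<and> (\<forall>i<n. v i = x (s i))"
    if v: "valuation M v" "sat M v q" for v
  proof -
    obtain w where w: "valuation M w" "\<forall>i<n. w i = v i" "sat M w r"
      using sat_exs[OF v(1) r] v(2) by (auto simp: q_def)
    have "valuation M (\<lambda>i. w (n + i))" using w(1) by auto
    moreover have "sat M (\<lambda>i. w (n + i)) p" "\<forall>i<n. v i = w (n + s i)"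
      using w sat_r by auto
    ultimately show ?thesis by (intro exI[of _ "\<lambda>i. w (n + i)"]) simp
  qed
  have uq: "sat M (u \<circ> s) q"
  proof -
    have v: "valuation M (u \<circ> s)" using u by auto
    define w where "w i = (if i < n then u (s i) else u (i - n))" for i
    have "valuation M w" using u by (auto simp: w_def)
    moreover have "sat M w r" using p(2) s unfolding sat_r by (simp add: w_def)
    ultimately show ?thesis unfolding q_def sat_exs[OF v r]
      by (intro exI[of _ w]) (simp add: w_def)
  qed
  have "ftype L M n v = ftype L M n v'"
    if v: "valuation M v" "sat M v q" and v': "valuation M v'" "sat M v' q" for v v'
  proof -
    obtain x where x: "valuation M x" "sat M x p" "\<forall>i<n. v i = x (s i)" using sat_q[OF v] by blast
    obtain x' where x': "valuation M x'" "sat M x' p" "\<forall>i<n. v' i = x' (s i)"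
      using sat_q[OF v'] by blast
    have eq: "ftype L M k x = ftype L M k x'" using p(1) x x' unfolding isolates_def by blast
    have "sat M v d \<longleftrightarrow> sat M v' d" if d: "d \<in> formulas L n" for d
    proof -
      have "ren d s \<in> formulas L k"
      proof -
        have "free_vars (ren d s) \<subseteq> s ` free_vars d" by (rule free_vars_ren)
        also have "\<dots> \<subseteq> {..<k}" using d s by (auto simp: formulas_def)
        finally show ?thesis using d by (simp add: formulas_def wf_ren)
      qed
      then have "sat M x (ren d s) \<longleftrightarrow> sat M x' (ren d s)" using eq by (simp add: ftype_eq_iff)
      moreover have "sat M v d \<longleftrightarrow> sat M (x \<circ> s) d"
        by (rule sat_cong_formulas[OF d]) (use x in simp)
      moreover have "sat M v' d \<longleftrightarrow> sat M (x' \<circ> s) d"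
        by (rule sat_cong_formulas[OF d]) (use x' in simp)
      ultimately show ?thesis by (simp only: sat_ren)
    qed
    then show ?thesis by (simp add: ftype_eq_iff)
  qed
  moreover have "valuation M (u \<circ> s)" using u by auto
  ultimately have "isolates L M n q" using q uq unfolding isolates_def by blast
  with uq show ?thesis by blast
qed

text \<open>Density allows one to choose the Henkin witnesses so that all initial segments have isolated types. The
  elementary substructure obtained in this way is isomorphic to \<open>M\<close>.\<close>

lemma atomic_if_omega_categorical:
  fixes M :: "('s, 'a) interp"
  assumes L: "countable_language L" and oc: "omega_categorical L M"
  shows "atomic L M"
proof -
  have M: "fo_structure L M" using oc by (simp add: omega_categorical_def)
  note dense = isolated_types_dense[OF L oc]
  obtain E :: "nat \<Rightarrow> nat \<times> 's fo_form" where
    E: "\<And>i. wf_form L (snd (E i))" "\<And>i. free_vars (snd (E i)) \<subseteq> {..fst (E i)}"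
      "\<And>k p m. wf_form L p \<Longrightarrow> free_vars p \<subseteq> {..k} \<Longrightarrow> \<exists>i\<ge>m. E i = (k, p)"
    using task_enumeration[OF L] by blast
  define I where "I i w \<longleftrightarrow> (\<exists>p. isolates L M i p \<and> sat M w p)" for i w
  \<comment> \<open>a formula that can be satisfied by a new value can also be satisfied by one that keeps the type of
    the prolonged tuple isolated\<close>
  have extend: "\<exists>a\<in>Dom M. I (Suc i) (w(i := a)) \<and> sat M (w(i := a)) q"
    if w: "valuation M w" "I i w" and q: "q \<in> formulas L (Suc i)" "b \<in> Dom M" "sat M (w(i := b)) q"
    for i w q b
  proof -
    obtain p where p: "isolates L M i p" "sat M w p" using w(2) by (auto simp: I_def)
    have pf: "p \<in> formulas L i" using p by (simp add: isolates_def)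
    have "sat M (w(i := b)) (FConj p q)"
      using q(3) p(2) sat_cong_formulas[OF pf, of "w(i := b)" w M] by simp
    moreover have "FConj p q \<in> formulas L (Suc i)" using q(1) formulas_mono[OF pf, of "Suc i"] by simp
    ultimately obtain d where d: "isolates L M (Suc i) d"
      "\<And>x. valuation M x \<Longrightarrow> sat M x d \<Longrightarrow> sat M x (FConj p q)"
      using dense[of "FConj p q" "Suc i" "w(i := b)"] valuation_upd[OF w(1) q(2)] by blast
    then obtain x where x: "valuation M x" "sat M x d" unfolding isolates_def by blast
    then have "sat M x p" using d(2)[OF x] by simp
    then have "ftype L M i x = ftype L M i w" using p x(1) w(1) unfolding isolates_def by blast
    moreover have "FEx i d \<in> formulas L i" using d(1) by (intro FEx_in_formulas) (simp add: isolates_def)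
    moreover have "sat M x (FEx i d)"
    proof -
      have "sat M (x(i := x i)) d" "x i \<in> Dom M" using x by auto
      then show ?thesis by (simp only: sat.simps) blast
    qed
    ultimately have "sat M w (FEx i d)" unfolding ftype_eq_iff by blast
    then obtain a where a: "a \<in> Dom M" "sat M (w(i := a)) d" by auto
    then have "sat M (w(i := a)) q" using d(2)[OF valuation_upd[OF w(1) a(1)] a(2)] by simp
    with a d(1) show ?thesis unfolding I_def by blast
  qed
  obtain v0 where v0: "valuation M v0" using valuation_exists[OF M] by blast
  have "\<exists>v. valuation M v \<and> I 0 v"
  proof -
    have "FTrue \<in> formulas L 0" "sat M v0 FTrue" by (simp_all add: formulas_def FTrue_def)
    from dense[OF this(1) v0 this(2)] show ?thesis unfolding isolates_def I_def by blast
  qed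
  then obtain v where v: "valuation M v" "I 0 v" by blast
  have step: "\<exists>a\<in>Dom M. I (Suc i) (w(i := a)) \<and>
        (fst (E i) < i \<longrightarrow> sat M w (FEx (fst (E i)) (snd (E i))) \<longrightarrow>
          sat M (w(fst (E i) := a)) (snd (E i)))"
    if w: "valuation M w" "I i w" for i w
  proof (cases "fst (E i) < i \<and> sat M w (FEx (fst (E i)) (snd (E i)))")
    case True
    define k p where "k = fst (E i)" and "p = snd (E i)"
    from True obtain b where b: "b \<in> Dom M" "sat M (w(k := b)) p" and ki: "k < i"
      by (auto simp: k_def p_def)
    have fv: "free_vars p \<subseteq> {..k}" "wf_form L p" using E by (auto simp: k_def p_def)
    have eq: "sat M (w(i := a)) (ren p (id(k := i))) \<longleftrightarrow> sat M (w(k := a)) p" for a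
      unfolding sat_ren by (rule sat_cong) (use fv ki in auto)
    have "ren p (id(k := i)) \<in> formulas L (Suc i)"
    proof -
      have "free_vars (ren p (id(k := i))) \<subseteq> (id(k := i)) ` free_vars p" by (rule free_vars_ren)
      also have "\<dots> \<subseteq> {..<Suc i}" using fv ki by auto
      finally show ?thesis using fv by (simp add: formulas_def wf_ren)
    qed
    from extend[OF w this b(1)] show ?thesis
      unfolding eq k_def[symmetric] p_def[symmetric] using b(2) by blast
  next
    case False
    have "FTrue \<in> formulas L (Suc i)" "sat M (w(i := w 0)) FTrue" "w 0 \<in> Dom M"
      using w(1) by (auto simp: formulas_def FTrue_def)
    from extend[OF w this(1,3,2)] False show ?thesis by blast
  qed
  have cong: "I i w'" if w: "I i w" "\<And>j. j < i \<Longrightarrow> w' j = w j" for i w w'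
  proof -
    obtain p where p: "isolates L M i p" "sat M w p" using w(1) by (auto simp: I_def)
    then have "p \<in> formulas L i" by (simp add: isolates_def)
    from sat_cong_formulas[OF this, of w' w M] w(2) p show ?thesis by (auto simp: I_def)
  qed
  have "\<exists>u. valuation M u \<and> (\<forall>i<0. u i = v i) \<and> (\<forall>i\<ge>0. I i u) \<and>
    (\<forall>i\<ge>0. fst (E i) < i \<longrightarrow> sat M u (FEx (fst (E i)) (snd (E i))) \<longrightarrow>
      sat M (u(fst (E i) := u i)) (snd (E i)))"
  proof (rule witnessing_assignment[where I = I])
    fix i w w' assume "I i w" "\<And>j. j < i \<Longrightarrow> w' j = w j"
    then show "I i w'" by (rule cong)
  qed (intro v E(2) step; assumption)+
  then obtain u where u: "valuation M u" "\<forall>i\<ge>0. I i u"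
    "\<forall>i\<ge>0. fst (E i) < i \<longrightarrow> sat M u (FEx (fst (E i)) (snd (E i))) \<longrightarrow>
      sat M (u(fst (E i) := u i)) (snd (E i))"
    by (elim exE conjE) (rule that)
  have "\<exists>c. range c = Dom M \<and> (\<forall>p s. wf_form L p \<longrightarrow>
      (sat M (c \<circ> s) p \<longleftrightarrow> (\<forall>\<^sub>F m :: nat in sequentially. sat M (u \<circ> s) p)))"
  proof (rule limit_structure_isomorphic[OF oc])
    fix k and p :: "'s fo_form" assume p: "wf_form L p" "free_vars p \<subseteq> {..k}"
    obtain i where i: "i \<ge> Suc k" "E i = (k, p)" using E(3)[OF p] by blast
    with u(3)[rule_format, of i] have "sat M u (FEx k p) \<longrightarrow> sat M (u(k := u i)) p" by simp
    then show "\<exists>n. \<forall>m::nat. sat M u (FEx k p) \<longrightarrow> sat M (u(k := u n)) p" by blast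
  qed (use u(1) in auto)
  then obtain c where c: "range c = Dom M" "\<And>p s. wf_form L p \<Longrightarrow>
      sat M (c \<circ> s) p \<longleftrightarrow> sat M (u \<circ> s) p" by auto
  show ?thesis
    unfolding atomic_def
  proof (intro allI impI)
    fix n v assume v: "valuation M v"
    define s where "s i = (SOME j. c j = v i)" for i
    have "c (s i) = v i" for i
      unfolding s_def
    proof (rule someI_ex)
      have "v i \<in> range c" using v c(1) by blast
      then show "\<exists>j. c j = v i" by auto
    qed
    then have s: "c \<circ> s = v" by auto
    obtain k where k: "s ` {..<n} \<subseteq> {..<k}" using finite_nat_iff_bounded[of "s ` {..<n}"] by auto
    obtain p where p: "isolates L M k p" "sat M u p" using u(2) by (auto simp: I_def)
    obtain q where q: "isolates L M n q" "sat M (u \<circ> s) q"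
      using isolates_subtuple[OF p u(1), of n s] k by auto
    have "wf_form L q" using q(1) by (auto simp: isolates_def formulas_def)
    with c(2)[of q s] q s show "\<exists>p. isolates L M n p \<and> sat M v p" by auto
  qed
qed

text \<open>The negations of the isolating formulas are not realised together in an atomic structure. By weak
  saturation finitely many of them are contradictory already, and the corresponding types are all types
  there are.\<close>

theorem finitely_many_types_if_omega_categorical:
  fixes M :: "('s, 'a) interp"
  assumes L: "countable_language L" and oc: "omega_categorical L M"
  shows "finite {ftype L M n v |v. valuation M v}"
proof -
  have M: "fo_structure L M" using oc by (simp add: omega_categorical_def)
  have at: "atomic L M" by (rule atomic_if_omega_categorical[OF L oc])
  define C where "C = {p. isolates L M n p}"
  have "C \<subseteq> {p. wf_form L p}" by (auto simp: C_def isolates_def formulas_def)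
  then have cC: "countable C" using countable_formulas[OF L] by (rule countable_subset)
  obtain v0 where v0: "valuation M v0" using valuation_exists[OF M] by blast
  then have "C \<noteq> {}" using at unfolding atomic_def C_def by blast
  then have rC: "range (from_nat_into C) = C" using cC by (intro range_from_nat_into)
  define c where "c = from_nat_into C"
  have c: "isolates L M n (c i)" for i using rC by (auto simp: c_def C_def)
  have "\<exists>k. \<forall>v. valuation M v \<longrightarrow> (\<exists>i\<le>k. sat M v (c i))"
  proof (rule ccontr)
    assume "\<not> ?thesis"
    then have fs: "\<exists>v. valuation M v \<and> (\<forall>i\<le>k. sat M v (FNeg (c i)))" for k
      by (simp only: sat.simps) blast
    have "FNeg (c i) \<in> formulas L n" for i using c by (simp add: isolates_def)
    from weakly_saturated_if_omega_categorical[OF L oc this fs]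
    obtain v where v: "valuation M v" "\<And>i. \<not> sat M v (c i)" by auto
    from at v(1) obtain p where p: "isolates L M n p" "sat M v p" unfolding atomic_def by blast
    then obtain i where "p = c i" using rC by (auto simp: C_def c_def)
    with p v show False by blast
  qed
  then obtain k where k: "\<And>v. valuation M v \<Longrightarrow> \<exists>i\<le>k. sat M v (c i)" by blast
  have "\<exists>v. valuation M v \<and> sat M v (c i)" for i using c unfolding isolates_def by blast
  then obtain d where d: "\<And>i. valuation M (d i) \<and> sat M (d i) (c i)" by metis
  have "ftype L M n v \<in> (\<lambda>i. ftype L M n (d i)) ` {..k}" if v: "valuation M v" for v
  proof -
    obtain i where i: "i \<le> k" "sat M v (c i)" using k[OF v] by blast
    then have "ftype L M n v = ftype L M n (d i)"
      using c[of i] d[of i] v unfolding isolates_def by blast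
    with i show ?thesis by blast
  qed
  then have "{ftype L M n v |v. valuation M v} \<subseteq> (\<lambda>i. ftype L M n (d i)) ` {..k}" by blast
  then show ?thesis by (rule finite_subset) simp
qed

lemma isomorphism_restrict:
  assumes "fo_structure L M" "isomorphism L M N h"
  shows "isomorphism L M N (restrict h (Dom M))"
proof -
  have eq: "map (restrict h (Dom M)) xs = map h xs" if "xs \<in> tuples n (Dom M)" for n xs
    using that by (auto simp: tuples_def)
  have "fun_of M f xs \<in> Dom M" if "f \<in> funs L" "xs \<in> tuples (snd f) (Dom M)" for f xs
    using assms(1) that by (simp add: fo_structure_def)
  note closed = this
  show ?thesis
    unfolding isomorphism_def
  proof (intro conjI ballI)
    show "bij_betw (restrict h (Dom M)) (Dom M) (Dom N)"
      using isomorphism_bij[OF assms(2)] by (simp add: bij_betw_restrict_eq)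
  next
    fix f xs assume "f \<in> funs L" "xs \<in> tuples (snd f) (Dom M)"
    then show "restrict h (Dom M) (fun_of M f xs) = fun_of N f (map (restrict h (Dom M)) xs)"
      using assms(2) closed eq by (simp only: isomorphism_def restrict_apply' )
  next
    fix r xs assume "r \<in> rels L" "xs \<in> tuples (snd r) (Dom M)"
    then show "rel_of M r xs \<longleftrightarrow> rel_of N r (map (restrict h (Dom M)) xs)"
      using assms(2) eq by (simp only: isomorphism_def)
  qed
qed

text \<open>By back-and-forth the orbit of a pair is the set of all pairs of the same type.\<close>

theorem finitely_many_orbits_if_omega_categorical:
  fixes M :: "('s, 'a) interp"
  assumes L: "countable_language L" and oc: "omega_categorical L M"
  shows "finite (orbits_on_pairs (Dom M) (Aut L M))"
proof -
  have M: "fo_structure L M" "countable (Dom M)" using oc by (auto simp: omega_categorical_def)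
  have at: "atomic L M" by (rule atomic_if_omega_categorical[OF L oc])
  define pr where "pr a b = (\<lambda>i::nat. if i = 0 then a else b)" for a b :: 'a
  have pr: "valuation M (pr a b)" if "a \<in> Dom M" "b \<in> Dom M" for a b
    using that by (auto simp: pr_def)
  define cls where "cls t = {(a, b). a \<in> Dom M \<and> b \<in> Dom M \<and> ftype L M 2 (pr a b) = t}" for t
  have "orbit (perm_group (Dom M) (Aut L M)) (\<lambda>h. \<lambda>p\<in>Dom M \<times> Dom M. (h (fst p), h (snd p))) (a, b)
      = cls (ftype L M 2 (pr a b))" if ab: "a \<in> Dom M" "b \<in> Dom M" for a b
  proof -
    have "ftype L M 2 (pr (h a) (h b)) = ftype L M 2 (pr a b) \<and> h a \<in> Dom M \<and> h b \<in> Dom M"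
      if h: "h \<in> Aut L M" for h
    proof -
      have iso: "isomorphism L M M h" using h by (simp add: Aut_def)
      have "h \<circ> pr a b = pr (h a) (h b)" by (auto simp: pr_def)
      then have "sat M (pr (h a) (h b)) p \<longleftrightarrow> sat M (pr a b) p" if "p \<in> formulas L 2" for p
        using sat_isomorphism[OF iso M(1) pr[OF ab] formulas_wf[OF that]] by simp
      then show ?thesis using isomorphism_bij[OF iso] ab
        by (auto simp: ftype_eq_iff bij_betw_def)
    qed
    moreover have "\<exists>h\<in>Aut L M. h a = a' \<and> h b = b'"
      if ab': "a' \<in> Dom M" "b' \<in> Dom M" "ftype L M 2 (pr a' b') = ftype L M 2 (pr a b)" for a' b'
    proof -
      obtain h where h: "isomorphism L M M h" "\<forall>i<2. h (pr a b i) = pr a' b' i"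
        using back_and_forth[OF M at M at pr[OF ab] pr[OF ab'(1,2)] ab'(3)[symmetric]] by blast
      have "restrict h (Dom M) \<in> Aut L M"
        using isomorphism_restrict[OF M(1) h(1)] isomorphism_bij[OF h(1)]
        by (simp add: Aut_def Bij_def bij_betw_restrict_eq)
      moreover have "h a = a'" "h b = b'"
        using h(2)[rule_format, of 0] h(2)[rule_format, of 1] by (simp_all add: pr_def)
      ultimately show ?thesis using ab by (intro bexI[of _ "restrict h (Dom M)"]) auto
    qed
    ultimately have aut: "h \<in> Aut L M \<Longrightarrow> (h a, h b) \<in> cls (ftype L M 2 (pr a b))"
      and hom: "(a', b') \<in> cls (ftype L M 2 (pr a b)) \<Longrightarrow> \<exists>h\<in>Aut L M. h a = a' \<and> h b = b'"
      for h a' b'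
      by (simp_all add: cls_def)
    show ?thesis
    proof (intro Set.set_eqI iffI)
      fix q assume "q \<in> orbit (perm_group (Dom M) (Aut L M))
        (\<lambda>h. \<lambda>p\<in>Dom M \<times> Dom M. (h (fst p), h (snd p))) (a, b)"
      then show "q \<in> cls (ftype L M 2 (pr a b))"
        using aut ab by (auto simp: orbit_def perm_group_def)
    next
      fix q assume "q \<in> cls (ftype L M 2 (pr a b))"
      then obtain h where "h \<in> Aut L M" "q = (h a, h b)" using hom[of "fst q" "snd q"] by auto
      then show "q \<in> orbit (perm_group (Dom M) (Aut L M))
        (\<lambda>h. \<lambda>p\<in>Dom M \<times> Dom M. (h (fst p), h (snd p))) (a, b)"
        using ab by (auto simp: orbit_def perm_group_def intro!: exI[of _ h])
    qed
  qed
  then have "orbits_on_pairs (Dom M) (Aut L M) \<subseteq>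
      (\<lambda>(a, b). cls (ftype L M 2 (pr a b))) ` (Dom M \<times> Dom M)"
    by (auto simp: orbits_on_pairs_def orbits_def)
  also have "\<dots> \<subseteq> cls ` {ftype L M 2 v |v. valuation M v}"
  proof (intro subsetI, elim imageE)
    fix x q assume "q \<in> Dom M \<times> Dom M" "x = (case q of (a, b) \<Rightarrow> cls (ftype L M 2 (pr a b)))"
    then show "x \<in> cls ` {ftype L M 2 v |v. valuation M v}"
      using pr[of "fst q" "snd q"] by (intro image_eqI[of _ _ "ftype L M 2 (pr (fst q) (snd q))"]) auto
  qed
  finally have "orbits_on_pairs (Dom M) (Aut L M) \<subseteq> cls ` {ftype L M 2 v |v. valuation M v}" .
  then show ?thesis
    by (rule finite_subset) (simp add: finitely_many_types_if_omega_categorical[OF L oc])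
qed


section \<open>Parities over affine cubes\<close>

unbundle bit_operations_syntax

lemma xor_eq_0_iff: "x XOR y = 0 \<longleftrightarrow> x = y" for x y :: nat
  by (metis xor.assoc xor.left_neutral xor.right_neutral xor_self_eq)

lemma xor_left_self: "x XOR (x XOR y) = y" for x y :: nat
  by (simp add: xor.assoc[symmetric])

lemmas xor_ac = xor.assoc xor.commute xor.left_commute

lemma xor_less_exp: "x < 2 ^ m \<Longrightarrow> y < 2 ^ m \<Longrightarrow> x XOR y < 2 ^ m" for x y :: nat
  by (metis take_bit_nat_eq_self_iff take_bit_xor)

text \<open>The parity of \<open>h\<close> over the affine cube with corner \<open>a\<close> and edges \<open>xs\<close>, in other words the iterated
  derivative of \<open>h\<close> in the directions \<open>xs\<close> at \<open>a\<close>.\<close>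

primrec cube :: "(nat \<Rightarrow> bool) \<Rightarrow> nat \<Rightarrow> nat list \<Rightarrow> bool" where
  "cube h a [] = h a"
| "cube h a (x # xs) = (cube h a xs \<noteq> cube h (a XOR x) xs)"

primrec xor_span :: "nat list \<Rightarrow> nat set" where
  "xor_span [] = {0}"
| "xor_span (x # xs) = xor_span xs \<union> (\<lambda>y. x XOR y) ` xor_span xs"

lemma xor_span_closed:
  "y \<in> xor_span xs \<Longrightarrow> z \<in> xor_span xs \<Longrightarrow> y XOR z \<in> xor_span xs"
proof (induction xs arbitrary: y z)
  case (Cons x xs)
  have img: "x XOR w \<in> (\<lambda>y. x XOR y) ` xor_span xs" if "w \<in> xor_span xs" for w
    using that by blast
  consider "y \<in> xor_span xs" "z \<in> xor_span xs"
    | u where "y \<in> xor_span xs" "u \<in> xor_span xs" "z = x XOR u"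
    | u where "u \<in> xor_span xs" "y = x XOR u" "z \<in> xor_span xs"
    | u u' where "u \<in> xor_span xs" "y = x XOR u" "u' \<in> xor_span xs" "z = x XOR u'"
    using Cons.prems by auto
  then show ?case
  proof cases
    case 1
    with Cons.IH show ?thesis by simp
  next
    case 2
    with img[OF Cons.IH[of y u]] show ?thesis by (simp add: xor.left_commute)
  next
    case 3
    with img[OF Cons.IH[of u z]] show ?thesis by (simp add: xor.assoc)
  next
    case 4
    then have "y XOR z = u XOR u'" by (simp add: xor_ac xor_left_self)
    with 4 Cons.IH show ?thesis by simp
  qed
qed simp

lemma finite_xor_span: "finite (xor_span xs)"
  by (induction xs) auto

lemma xor_span_subset:
  assumes "0 \<in> A" "\<And>x y. x \<in> A \<Longrightarrow> y \<in> A \<Longrightarrow> x XOR y \<in> A"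
  shows "set xs \<subseteq> A \<Longrightarrow> xor_span xs \<subseteq> A"
  using assms by (induction xs) auto

lemma cube_shift: "y \<in> xor_span xs \<Longrightarrow> cube h (a XOR y) xs = cube h a xs"
proof (induction xs arbitrary: a y)
  case (Cons x xs)
  consider "y \<in> xor_span xs" | z where "z \<in> xor_span xs" "y = x XOR z"
    using Cons.prems by auto
  then show ?case
  proof cases
    case 1
    have "(a XOR y) XOR x = (a XOR x) XOR y" by (simp add: xor_ac)
    then show ?thesis using Cons.IH[OF 1] by simp
  next
    case 2
    have "(a XOR y) XOR x = a XOR z" "a XOR y = (a XOR x) XOR z"
      by (simp_all add: 2 xor_ac xor_left_self)
    then show ?thesis using Cons.IH[OF 2(1)] by simp blast
  qed
qed simp

text \<open>The cube over \<open>x # xs\<close> compares the cube over \<open>xs\<close> at the corner \<open>a\<close> with the one at \<open>a XOR x\<close>. The two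
  agree when \<open>x\<close> is in the span of \<open>xs\<close>, so that dependent edges give parity 0.\<close>

lemma cube_dependent: "card (xor_span xs) = 2 ^ length xs \<or> (\<forall>a. \<not> cube h a xs)"
proof (induction xs)
  case (Cons x xs)
  show ?case
  proof (cases "x \<in> xor_span xs")
    case True
    then show ?thesis using cube_shift by simp
  next
    case False
    have "xor_span xs \<inter> (\<lambda>y. x XOR y) ` xor_span xs = {}"
    proof (rule ccontr)
      assume "\<not> ?thesis"
      then obtain y where y: "y \<in> xor_span xs" "x XOR y \<in> xor_span xs" by auto
      from xor_span_closed[OF y(2,1)] have "x \<in> xor_span xs" by (simp add: xor.assoc)
      with False show False by simp
    qed
    moreover have "inj_on (\<lambda>y. x XOR y) (xor_span xs)"
      by (rule inj_onI) (metis xor_left_self)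
    ultimately have "card (xor_span (x # xs)) = 2 * card (xor_span xs)"
      by (simp add: card_Un_disjoint finite_xor_span card_image)
    with Cons.IH show ?thesis by auto
  qed
qed simp

text \<open>In a finite subspace there is no room for many independent edges. The cardinality itself is a
  convenient bound on the dimension.\<close>

lemma cube_vanishes:
  assumes A: "finite A" "0 \<in> A" "\<And>x y. x \<in> A \<Longrightarrow> y \<in> A \<Longrightarrow> x XOR y \<in> A"
    and xs: "set xs \<subseteq> A" "card A \<le> length xs"
  shows "\<not> cube h a xs"
proof
  assume "cube h a xs"
  then have "2 ^ length xs = card (xor_span xs)" using cube_dependent[of xs h] by auto
  also have "\<dots> \<le> card A" by (rule card_mono[OF A(1) xor_span_subset[OF A(2,3) xs(1)]])
  finally show False using xs(2) less_exp[of "length xs"] by linarith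
qed

lemma cube_cong:
  "(\<And>v. v < 2 ^ m \<Longrightarrow> h (a XOR v) = g (a XOR v)) \<Longrightarrow> set xs \<subseteq> {..<2 ^ m} \<Longrightarrow>
    cube h a xs = cube g a xs"
proof (induction xs arbitrary: a)
  case Nil
  from Nil(1)[of 0] show ?case by simp
next
  case (Cons x xs)
  have x: "x < 2 ^ m" using Cons.prems(2) by simp
  have "cube h a xs = cube g a xs" by (rule Cons.IH) (use Cons.prems in auto)
  moreover have "cube h (a XOR x) xs = cube g (a XOR x) xs"
  proof (rule Cons.IH)
    fix v :: nat assume "v < 2 ^ m"
    then show "h ((a XOR x) XOR v) = g ((a XOR x) XOR v)"
      using Cons.prems(1)[of "x XOR v"] x by (simp add: xor.assoc xor_less_exp)
  qed (use Cons.prems in auto)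
  ultimately show ?case by simp
qed

lemma cube_False: "\<not> cube (\<lambda>_. False) a xs"
  by (induction xs arbitrary: a) auto

lemma cube_eq_longer:
  assumes "\<And>a xs. length xs = n \<Longrightarrow> cube g a xs = cube h a xs"
  shows "n \<le> length xs \<Longrightarrow> cube g a xs = cube h a xs"
proof (induction xs arbitrary: a)
  case (Cons x xs)
  show ?case
  proof (cases "length (x # xs) = n")
    case True
    then show ?thesis by (rule assms)
  next
    case False
    with Cons show ?thesis by simp
  qed
qed (use assms in simp)

lemma cube_comp:
  assumes "\<And>x y. f (x XOR y) = f x XOR f y"
  shows "cube (g \<circ> f) a xs = cube g (f a) (map f xs)"
  by (induction xs arbitrary: a) (simp_all add: assms)

section \<open>A generic sequence of functions\<close>

text \<open>Every finite set of pairs equals \<open>block j\<close> for infinitely many \<open>j\<close>: the second component of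
  \<open>prod_decode j\<close> is free.\<close>

definition block :: "nat \<Rightarrow> (nat \<times> nat) set" where
  "block j = {p. prod_encode p \<in> set_decode (fst (prod_decode j))}"

text \<open>The values at the numbers with leading bit \<open>2 ^ j\<close>, which form a coset of the subspace of all numbers
  below \<open>2 ^ j\<close>, are read off from \<open>block j\<close>.\<close>

definition generic :: "nat \<Rightarrow> nat \<Rightarrow> bool" where
  "generic n y \<longleftrightarrow> (\<exists>j v. v < 2 ^ j \<and> y = 2 ^ j + v \<and> (n, v) \<in> block j)"

lemma xor_exp: "v < 2 ^ j \<Longrightarrow> v XOR 2 ^ j = 2 ^ j + v" for v :: nat
proof -
  assume v: "v < 2 ^ j"
  have "v AND 2 ^ j = 0"
    using v by (metis and_exp_eq_0_iff_not_bit bit_take_bit_iff less_irrefl take_bit_nat_eq_self)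
  from disjunctive_add_eq_xor[OF this] show ?thesis by simp
qed

lemma generic_iff:
  assumes v: "v < 2 ^ j"
  shows "generic n (v XOR 2 ^ j) \<longleftrightarrow> (n, v) \<in> block j"
proof -
  have *: "\<not> i < k" if "(2::nat) ^ i + w = 2 ^ k + u" "w < 2 ^ i" for i k w u
  proof
    assume "i < k"
    then have "(2::nat) ^ Suc i \<le> 2 ^ k" by (intro power_increasing) auto
    with that show False by simp
  qed
  have "i = j \<and> w = v" if "2 ^ j + v = 2 ^ i + w" "w < 2 ^ i" for i w
  proof -
    from *[of j v i w] *[of i w j v] that v have "i = j" by simp
    with that show ?thesis by simp
  qed
  with v show ?thesis unfolding generic_def xor_exp[OF v] by blast
qed

text \<open>Genericity: over a finite subspace there is a new point \<open>b\<close> at which finitely many values on the coset of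
  \<open>b\<close> are prescribed at will, for all functions at once.\<close>

lemma generic_extension:
  assumes "finite D"
  shows "\<exists>b\<ge>2 ^ m. \<forall>n. \<forall>v<2 ^ m. generic n (v XOR b) \<longleftrightarrow> (n, v) \<in> D"
proof -
  define j where "j = prod_encode (set_encode (prod_encode ` D), m)"
  have j: "m \<le> j" unfolding j_def by (rule le_prod_encode_2)
  have "block j = D"
    using assms by (auto simp: block_def j_def inj_image_mem_iff[OF inj_prod_encode])
  moreover have le: "(2::nat) ^ m \<le> 2 ^ j" using j by (intro power_increasing) auto
  ultimately have "generic n (v XOR 2 ^ j) \<longleftrightarrow> (n, v) \<in> D" if "v < 2 ^ m" for n v
    using generic_iff[OF less_le_trans[OF that le], of n] by simp
  with le show ?thesis by blast
qed

text \<open>A new edge \<open>b\<close> such that all functions vanish on the coset of \<open>b\<close> leaves the parities of a cube as they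
  are.\<close>

lemma generic_cube_neq:
  assumes "n \<noteq> m"
  shows "\<exists>a xs. length xs = k \<and> cube (generic n) a xs \<noteq> cube (generic m) a xs"
proof (induction k)
  case 0
  obtain b where "\<forall>i. generic i (0 XOR b) \<longleftrightarrow> (i, 0) \<in> {(n, 0::nat)}"
    using generic_extension[of "{(n, 0)}" 0] by auto
  with assms show ?case by (intro exI[of _ b] exI[of _ "[]"]) simp
next
  case (Suc k)
  then obtain a xs where IH: "length xs = k" "cube (generic n) a xs \<noteq> cube (generic m) a xs"
    by blast
  define M where "M = Max (insert a (set xs))"
  have M: "a < 2 ^ M" "set xs \<subseteq> {..<2 ^ M}"
  proof -
    have "x < 2 ^ M" if "x \<in> insert a (set xs)" for x
    proof -
      have "x \<le> M" unfolding M_def by (rule Max_ge) (use that in auto)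
      with less_exp[of M] show ?thesis by linarith
    qed
    then show "a < 2 ^ M" "set xs \<subseteq> {..<2 ^ M}" by auto
  qed
  obtain b where b: "\<And>i v. v < 2 ^ M \<Longrightarrow> \<not> generic i (v XOR b)"
    using generic_extension[of "{}" M] by auto
  have "\<not> cube (generic i) (a XOR b) xs" for i
  proof -
    have "cube (generic i) (a XOR b) xs = cube (\<lambda>_. False) (a XOR b) xs"
    proof (rule cube_cong[OF _ M(2)])
      fix v :: nat assume "v < 2 ^ M"
      with b[of "a XOR v" i] M(1) show "generic i ((a XOR b) XOR v) = False"
        by (simp add: xor_less_exp xor_ac)
    qed
    with cube_False show ?thesis by simp
  qed
  with IH show ?case by (intro exI[of _ a] exI[of _ "b # xs"]) simp
qed

section \<open>The structure\<close>

definition cube_language :: "name language" where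
  "cube_language = \<lparr>funs = {}, rels = insert (1, 3) ({0} \<times> UNIV)\<rparr>"

text \<open>The name 0 is shared by all parity relations, which are told apart by their arities: the first
  argument is the corner and the others are the edges. At arity 0 the relation is false. The symbol
  \<open>(1, 3)\<close> stands for the graph of the addition.\<close>

definition cube_structure :: "(name, nat) interp" where
  "cube_structure = \<lparr>Dom = UNIV, fun_of = (\<lambda>_ _. 0), rel_of = (\<lambda>r xs.
     if fst r = 0 then xs \<noteq> [] \<and> cube (generic (length (tl xs))) (hd xs) (tl xs)
     else xs ! 2 = xs ! 0 XOR xs ! 1)\<rparr>"

lemma Dom_cube_structure [simp]: "Dom cube_structure = UNIV"
  by (simp add: cube_structure_def)

lemma fo_structure_cube_structure: "fo_structure cube_language cube_structure"
  by (simp add: fo_structure_def cube_language_def)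

lemma countable_cube_language: "countable_language cube_language"
  by (auto simp: countable_language_def cube_language_def)

text \<open>A partial isomorphism is represented by its graph, a finite subspace of the square of the space. In
  this form the notion is symmetric, and the back step reduces to the forth step.\<close>

definition partial_iso :: "(nat \<times> nat) set \<Rightarrow> bool" where
  "partial_iso p \<longleftrightarrow> finite p \<and> (0, 0) \<in> p \<and>
     (\<forall>x y x' y'. (x, y) \<in> p \<and> (x', y') \<in> p \<longrightarrow> (x XOR x', y XOR y') \<in> p) \<and>
     (\<forall>x y. (x, y) \<in> p \<longrightarrow> (x = 0 \<longleftrightarrow> y = 0)) \<and>
     (\<forall>z zs. z \<in> p \<and> set zs \<subseteq> p \<longrightarrow>
       cube (generic (length zs)) (fst z) (map fst zs) =
       cube (generic (length zs)) (snd z) (map snd zs))"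

lemma partial_iso_converse: "partial_iso p \<Longrightarrow> partial_iso (prod.swap ` p)"
proof -
  assume p: "partial_iso p"
  have mem: "(x, y) \<in> prod.swap ` p \<longleftrightarrow> (y, x) \<in> p" for x y by force
  have "cube (generic (length zs)) (fst z) (map fst zs) =
      cube (generic (length zs)) (snd z) (map snd zs)"
    if z: "z \<in> prod.swap ` p" "set zs \<subseteq> prod.swap ` p" for z zs
  proof -
    have "prod.swap z \<in> p" "set (map prod.swap zs) \<subseteq> p" using z by auto
    then have "cube (generic (length zs)) (fst (prod.swap z)) (map fst (map prod.swap zs)) =
      cube (generic (length zs)) (snd (prod.swap z)) (map snd (map prod.swap zs))"
      using p unfolding partial_iso_def by (metis length_map)
    then show ?thesis by (simp add: comp_def)
  qed
  with p show ?thesis unfolding partial_iso_def mem by blast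
qed

lemma partial_iso_injective:
  assumes "partial_iso p" "(x, y) \<in> p" "(x', y') \<in> p"
  shows "x = x' \<longleftrightarrow> y = y'"
proof -
  have "(x XOR x', y XOR y') \<in> p" using assms unfolding partial_iso_def by blast
  then have "x XOR x' = 0 \<longleftrightarrow> y XOR y' = 0" using assms(1) unfolding partial_iso_def by blast
  then show ?thesis by (simp add: xor_eq_0_iff)
qed

text \<open>Let \<open>a\<close> be a new point. The defect \<open>f\<^sub>n(x) + f\<^sub>n(y)\<close> on the pairs \<open>(x, y)\<close> of \<open>p\<close> has vanishing cubes. It
  is prolonged to the span of \<open>p\<close> and \<open>(a, b)\<close> along the projection to \<open>p\<close> that kills \<open>(a, b)\<close>, and
  \<open>b\<close> is chosen so that this prolongation is the defect of the extended isomorphism. For all but finitely many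
  \<open>n\<close> the cubes vanish on the extended domain and range by lack of dimension, so that finitely many
  conditions on \<open>b\<close> suffice.\<close>

lemma partial_iso_extend:
  assumes p: "partial_iso p"
  shows "\<exists>q b. partial_iso q \<and> p \<subseteq> q \<and> (a, b) \<in> q"
proof (cases "a \<in> fst ` p")
  case True
  with p show ?thesis by force
next
  case False
  have fin: "finite p" and zero: "(0, 0) \<in> p"
    and add: "\<And>x y x' y'. (x, y) \<in> p \<Longrightarrow> (x', y') \<in> p \<Longrightarrow> (x XOR x', y XOR y') \<in> p"
    and zero_iff: "\<And>x y. (x, y) \<in> p \<Longrightarrow> x = 0 \<longleftrightarrow> y = 0"
    and cubes: "\<And>z zs. z \<in> p \<Longrightarrow> set zs \<subseteq> p \<Longrightarrow>
       cube (generic (length zs)) (fst z) (map fst zs) =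
       cube (generic (length zs)) (snd z) (map snd zs)"
    using p unfolding partial_iso_def by blast+
  \<comment> \<open>the extension has at most \<open>N\<close> elements, hence vanishing cubes in dimension \<open>N\<close> and above\<close>
  define N where "N = 2 * card p"
  define m where "m = Max (snd ` p)"
  have m: "y < 2 ^ m" if "(x, y) \<in> p" for x y
  proof -
    have "y \<le> m" unfolding m_def by (rule Max_ge) (use that fin in force)+
    with less_exp[of m] show ?thesis by linarith
  qed
  define D where "D = {(n, y) |n x y. n \<le> N \<and> (x, y) \<in> p \<and>
    (generic n (x XOR a) \<noteq> (generic n x \<noteq> generic n y))}"
  have "D \<subseteq> {..N} \<times> snd ` p" by (force simp: D_def)
  then have "finite D" by (rule finite_subset) (simp add: fin)
  from generic_extension[OF this, of m] obtain b where b: "b \<ge> 2 ^ m"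
    "\<And>n v. v < 2 ^ m \<Longrightarrow> generic n (v XOR b) \<longleftrightarrow> (n, v) \<in> D" by blast
  have gen_b: "generic n (y XOR b) = (generic n (x XOR a) \<noteq> (generic n x \<noteq> generic n y))"
    if "(x, y) \<in> p" "n \<le> N" for n x y
  proof -
    have "x' = x" if "(x', y) \<in> p" for x'
      using partial_iso_injective[OF p that \<open>(x, y) \<in> p\<close>] by simp
    then show ?thesis using that b(2)[OF m[OF that(1)]] unfolding D_def by blast
  qed
  define sc where "sc e x = (if e then x else 0)" for e and x :: nat
  \<comment> \<open>elements of the extension are parametrised by an element of \<open>p\<close> and the coefficient of \<open>(a, b)\<close>\<close>
  define ext where "ext t = (fst (fst t) XOR sc (snd t) a, snd (fst t) XOR sc (snd t) b)"
    for t :: "(nat \<times> nat) \<times> bool"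
  define q where "q = ext ` (p \<times> UNIV)"
  have "finite q" using fin by (simp add: q_def)
  have q_I: "(x XOR sc e a, y XOR sc e b) \<in> q" if "(x, y) \<in> p" for x y e
    unfolding q_def by (rule image_eqI[of _ _ "((x, y), e)"]) (use that in \<open>auto simp: ext_def\<close>)
  have q_E: "\<exists>x' y' e. (x', y') \<in> p \<and> x = x' XOR sc e a \<and> y = y' XOR sc e b" if xy: "(x, y) \<in> q" for x y
  proof -
    from xy obtain t where "fst t \<in> p" "(x, y) = ext t" by (auto simp: q_def)
    then show ?thesis
      by (intro exI[of _ "fst (fst t)"] exI[of _ "snd (fst t)"] exI[of _ "snd t"]) (simp add: ext_def)
  qed
  have pq: "p \<subseteq> q" using q_I[of _ _ False] by (auto simp: sc_def)
  have ab: "(a, b) \<in> q" using q_I[OF zero, of True] by (simp add: sc_def)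
  have sc_add: "(x XOR sc e c) XOR (x' XOR sc e' c) = (x XOR x') XOR sc (e \<noteq> e') c" for x x' c e e'
    by (simp add: sc_def xor_ac xor_left_self)
  have add_q: "(x XOR x', y XOR y') \<in> q" if xy: "(x, y) \<in> q" "(x', y') \<in> q" for x y x' y'
  proof -
    obtain u v e where u: "(u, v) \<in> p" "x = u XOR sc e a" "y = v XOR sc e b" using q_E[OF xy(1)] by blast
    obtain u' v' e' where u': "(u', v') \<in> p" "x' = u' XOR sc e' a" "y' = v' XOR sc e' b"
      using q_E[OF xy(2)] by blast
    show ?thesis unfolding u u' sc_add by (rule q_I[OF add[OF u(1) u'(1)]])
  qed
  have zero_q: "x = 0 \<longleftrightarrow> y = 0" if xy: "(x, y) \<in> q" for x y
  proof -
    obtain u v e where u: "(u, v) \<in> p" "x = u XOR sc e a" "y = v XOR sc e b" using q_E[OF xy] by blast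
    show ?thesis
    proof (cases e)
      case True
      have "u \<noteq> a" using False u(1) by force
      moreover have "v \<noteq> b" using m[OF u(1)] b(1) by auto
      ultimately show ?thesis using True u by (simp add: sc_def xor_eq_0_iff)
    next
      case False
      with u zero_iff show ?thesis by (simp add: sc_def)
    qed
  qed
  \<comment> \<open>the defect of the extension over a cube equals the defect of \<open>p\<close> over the projected cube\<close>
  have lift: "cube (generic n) (snd (ext t)) (map (snd \<circ> ext) ts) =
      (cube (generic n) (fst (ext t)) (map (fst \<circ> ext) ts) \<noteq>
        (cube (generic n) (fst (fst t)) (map (fst \<circ> fst) ts) \<noteq>
         cube (generic n) (snd (fst t)) (map (snd \<circ> fst) ts)))"
    if "n \<le> N" "fst t \<in> p" "set (map fst ts) \<subseteq> p" for n t ts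
    using that(2,3)
  proof (induction ts arbitrary: t)
    case Nil
    obtain x y e where t: "t = ((x, y), e)" by (metis prod.collapse)
    then show ?case
      using gen_b[of x y n] Nil that(1) by (cases e) (auto simp: ext_def sc_def)
  next
    case (Cons s ts)
    define r where "r = ((fst (fst t) XOR fst (fst s), snd (fst t) XOR snd (fst s)), snd t \<noteq> snd s)"
    have "(fst (fst t), snd (fst t)) \<in> p" "(fst (fst s), snd (fst s)) \<in> p"
      using Cons.prems by simp_all
    from add[OF this] have rp: "fst r \<in> p" by (simp add: r_def)
    have ext_r: "fst (ext t) XOR fst (ext s) = fst (ext r)" "snd (ext t) XOR snd (ext s) = snd (ext r)"
      by (simp_all add: ext_def r_def sc_add)
    have fst_r: "fst (fst t) XOR fst (fst s) = fst (fst r)" "snd (fst t) XOR snd (fst s) = snd (fst r)"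
      by (simp_all add: r_def)
    have ts: "set (map fst ts) \<subseteq> p" using Cons.prems by simp
    show ?case
      using Cons.IH[OF Cons.prems(1) ts] Cons.IH[OF rp ts]
      by (simp only: cube.simps list.map o_apply ext_r fst_r) blast
  qed
  have cubes_q: "cube (generic (length zs)) (fst z) (map fst zs) =
       cube (generic (length zs)) (snd z) (map snd zs)" if z: "z \<in> q" "set zs \<subseteq> q" for z zs
  proof (cases "length zs \<le> N")
    case True
    obtain t where t: "z = ext t" "fst t \<in> p" using z(1) by (auto simp: q_def)
    have "\<forall>z\<in>set zs. \<exists>t. z = ext t \<and> fst t \<in> p" using z(2) by (force simp: q_def)
    then obtain f where f: "\<And>z. z \<in> set zs \<Longrightarrow> z = ext (f z) \<and> fst (f z) \<in> p" by metis
    define ts where "ts = map f zs"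
    have zs: "zs = map ext ts" unfolding ts_def using f by (auto intro!: map_idI[symmetric])
    have ts: "set (map fst ts) \<subseteq> p" unfolding ts_def using f by auto
    have "cube (generic (length zs)) (fst (fst t)) (map (fst \<circ> fst) ts) =
         cube (generic (length zs)) (snd (fst t)) (map (snd \<circ> fst) ts)"
      using cubes[OF t(2) ts] by (simp add: zs)
    with lift[OF True t(2) ts] show ?thesis by (simp add: zs t(1))
  next
    case False
    have "card q \<le> card (p \<times> (UNIV :: bool set))" unfolding q_def by (rule card_image_le) (simp add: fin)
    then have "card q \<le> N" by (simp add: N_def card_cartesian_product)
    then have card: "card (f ` q) \<le> length zs" for f :: "nat \<times> nat \<Rightarrow> nat"
      using card_image_le[OF \<open>finite q\<close>, of f] False by linarith
    have "(0, 0) \<in> q" using pq zero by blast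
    have "\<not> cube h c (map fst zs)" for h c
    proof (rule cube_vanishes[of "fst ` q"])
      show "x XOR y \<in> fst ` q" if "x \<in> fst ` q" "y \<in> fst ` q" for x y
        using that add_q by force
    qed (use \<open>finite q\<close> \<open>(0, 0) \<in> q\<close> z(2) card[of fst] in force)+
    moreover have "\<not> cube h c (map snd zs)" for h c
    proof (rule cube_vanishes[of "snd ` q"])
      show "x XOR y \<in> snd ` q" if "x \<in> snd ` q" "y \<in> snd ` q" for x y
        using that add_q by force
    qed (use \<open>finite q\<close> \<open>(0, 0) \<in> q\<close> z(2) card[of snd] in force)+
    ultimately show ?thesis by simp
  qed
  have "partial_iso q"
    unfolding partial_iso_def using \<open>finite q\<close> pq zero add_q zero_q cubes_q by blast
  with pq ab show ?thesis by blast
qed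

lemma partial_iso_sat:
  assumes "wf_form cube_language \<phi>" "partial_iso p" "\<And>i. i \<in> free_vars \<phi> \<Longrightarrow> (v i, w i) \<in> p"
  shows "sat cube_structure v \<phi> \<longleftrightarrow> sat cube_structure w \<phi>"
  using assms
proof (induction \<phi> arbitrary: v w p)
  case (FEq s t)
  then obtain i j where "s = Var i" "t = Var j"
    by (cases s; cases t) (auto simp: cube_language_def)
  with FEq.prems partial_iso_injective[of p "v i" "w i" "v j" "w j"] show ?case by simp
next
  case (FRel r ts)
  have "\<exists>i. t = Var i" if "t \<in> set ts" for t
    using FRel.prems(1) that by (cases t) (auto simp: cube_language_def list_all_iff)
  then obtain f where f: "\<And>t. t \<in> set ts \<Longrightarrow> t = Var (f t)" by metis
  define zs where "zs = map (\<lambda>t. (v (f t), w (f t))) ts"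
  have "i \<in> free_vars (FRel r ts)" if "Var i \<in> set ts" for i using that by force
  then have zs: "set zs \<subseteq> p" using f FRel.prems(3) unfolding zs_def by fastforce
  have eq: "term_val cube_structure u t = u (f t)" if "t \<in> set ts" for u t
    using f[OF that] by (metis term_val.simps(1))
  have mv: "map (term_val cube_structure v) ts = map fst zs"
    and mw: "map (term_val cube_structure w) ts = map snd zs"
    by (simp_all add: zs_def eq)
  show ?case
  proof (cases "fst r = 0")
    case True
    show ?thesis
    proof (cases zs)
      case Nil
      then show ?thesis unfolding sat.simps mv mw by simp
    next
      case (Cons z zs')
      with zs have "z \<in> p" "set zs' \<subseteq> p" by auto
      with FRel.prems(2) have "cube (generic (length zs')) (fst z) (map fst zs') =
          cube (generic (length zs')) (snd z) (map snd zs')"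
        unfolding partial_iso_def by blast
      with True Cons show ?thesis unfolding sat.simps mv mw by (simp add: cube_structure_def)
    qed
  next
    case False
    then have "length ts = 3" using FRel.prems(1) by (auto simp: cube_language_def)
    then have "length zs = 3" by (simp add: zs_def)
    then obtain z1 z2 z3 where zs3: "zs = [z1, z2, z3]"
      by (auto simp: numeral_3_eq_3 length_Suc_conv)
    with zs have z: "(fst z1, snd z1) \<in> p" "(fst z2, snd z2) \<in> p" "(fst z3, snd z3) \<in> p" by auto
    have "(fst z1 XOR fst z2, snd z1 XOR snd z2) \<in> p"
      using FRel.prems(2) z unfolding partial_iso_def by blast
    from partial_iso_injective[OF FRel.prems(2) z(3) this] False zs3
    show ?thesis unfolding sat.simps mv mw by (simp add: cube_structure_def)
  qed
next
  case (FNeg \<phi>)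
  have "wf_form cube_language \<phi>" using FNeg.prems(1) by simp
  from FNeg.IH[OF this FNeg.prems(2), of v w] FNeg.prems(3) show ?case by simp
next
  case (FConj \<phi> \<psi>)
  have "wf_form cube_language \<phi>" "wf_form cube_language \<psi>" using FConj.prems(1) by simp_all
  from FConj.IH(1)[OF this(1) FConj.prems(2), of v w] FConj.IH(2)[OF this(2) FConj.prems(2), of v w]
    FConj.prems(3) show ?case by simp
next
  case (FEx n \<phi>)
  have wf: "wf_form cube_language \<phi>" using FEx.prems(1) by simp
  have "\<exists>b. sat cube_structure (w(n := b)) \<phi>"
    if p: "partial_iso p" and vw: "\<And>i. i \<in> free_vars (FEx n \<phi>) \<Longrightarrow> (v i, w i) \<in> p"
      and a: "sat cube_structure (v(n := a)) \<phi>" for p v w a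
  proof -
    obtain q b where q: "partial_iso q" "p \<subseteq> q" "(a, b) \<in> q"
      using partial_iso_extend[OF p] by blast
    have "sat cube_structure (v(n := a)) \<phi> \<longleftrightarrow> sat cube_structure (w(n := b)) \<phi>"
      by (rule FEx.IH[OF wf q(1)]) (use vw q(2,3) in auto)
    with a show ?thesis by blast
  qed
  note forth = this
  have "(w i, v i) \<in> prod.swap ` p" if "i \<in> free_vars (FEx n \<phi>)" for i
    using FEx.prems(3)[OF that] by force
  note backward = forth[of "prod.swap ` p" w v, OF partial_iso_converse[OF FEx.prems(2)] this]
  note forth = forth[of p v w, OF FEx.prems(2,3)]
  have "(\<exists>a. sat cube_structure (v(n := a)) \<phi>) \<longleftrightarrow> (\<exists>a. sat cube_structure (w(n := a)) \<phi>)"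
    using forth backward by blast
  then show ?case by simp
qed

text \<open>Sets serve as coefficient vectors over the field with two elements; their addition is the symmetric
  difference.\<close>

primrec comb :: "(nat \<Rightarrow> nat) \<Rightarrow> nat \<Rightarrow> nat set \<Rightarrow> nat" where
  "comb v 0 S = 0"
| "comb v (Suc n) S = comb v n S XOR (if n \<in> S then v n else 0)"

lemma comb_xor: "comb v n S XOR comb v n T = comb v n {i. (i \<in> S) \<noteq> (i \<in> T)}"
proof (induction n)
  case (Suc n)
  have "comb v (Suc n) S XOR comb v (Suc n) T = (comb v n S XOR comb v n T) XOR
    ((if n \<in> S then v n else 0) XOR (if n \<in> T then v n else 0))"
    by (simp add: xor_ac)
  then show ?case by (simp add: Suc)
qed simp

lemma comb_empty: "comb v n {} = 0"
  by (induction n) auto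

lemma comb_singleton: "i < n \<Longrightarrow> comb v n {i} = v i"
proof (induction n)
  case (Suc n)
  have "comb v k {n} = 0" if "k \<le> n" for k using that by (induction k) auto
  with Suc show ?case by (cases "i = n") auto
qed simp

text \<open>The finite amount of information that determines the type of an \<open>n\<close>-tuple: the linear relations in it
  and the visible parities in its span. Its span has at most \<open>2 ^ n\<close> elements, which bounds the
  dimensions of the cubes to be considered.\<close>

definition diagram :: "nat \<Rightarrow> (nat \<Rightarrow> nat) \<Rightarrow> nat set set \<times> nat set list set" where
  "diagram n v = ({S. S \<subseteq> {..<n} \<and> comb v n S = 0},
     {Ss. set Ss \<subseteq> Pow {..<n} \<and> length Ss \<le> Suc (2 ^ n) \<and> Ss \<noteq> [] \<and>
       cube (generic (length (tl Ss))) (comb v n (hd Ss)) (map (comb v n) (tl Ss))})"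

lemma finite_diagrams: "finite (range (diagram n))"
proof (rule finite_subset)
  show "range (diagram n) \<subseteq> Pow (Pow {..<n}) \<times> Pow {Ss. set Ss \<subseteq> Pow {..<n} \<and> length Ss \<le> Suc (2 ^ n)}"
    by (auto simp: diagram_def)
  show "finite (Pow (Pow {..<n}) \<times> Pow {Ss. set Ss \<subseteq> Pow {..<n} \<and> length Ss \<le> Suc (2 ^ n)})"
    by (intro finite_cartesian_product finite_Pow_iff[THEN iffD2] finite_lists_length_le) auto
qed

lemma partial_iso_of_diagram:
  assumes eq: "diagram n v = diagram n w"
  shows "partial_iso {(comb v n S, comb w n S) |S. S \<subseteq> {..<n}}" (is "partial_iso ?p")
proof -
  have p: "?p = (\<lambda>S. (comb v n S, comb w n S)) ` Pow {..<n}" by auto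
  have fin: "finite ?p" unfolding p by simp
  have "card ?p \<le> card (Pow {..<n})" unfolding p by (rule card_image_le) simp
  then have card_p: "card ?p \<le> 2 ^ n" by (simp add: card_Pow)
  have zero: "(0, 0) \<in> ?p" using comb_empty[of v n] comb_empty[of w n] by force
  have add: "(x XOR x', y XOR y') \<in> ?p" if xy: "(x, y) \<in> ?p" "(x', y') \<in> ?p" for x y x' y'
  proof -
    obtain S where S: "S \<subseteq> {..<n}" "x = comb v n S" "y = comb w n S" using xy(1) by auto
    obtain T where T: "T \<subseteq> {..<n}" "x' = comb v n T" "y' = comb w n T" using xy(2) by auto
    have "{i. (i \<in> S) \<noteq> (i \<in> T)} \<subseteq> {..<n}" using S T by auto
    then show ?thesis unfolding S T comb_xor by blast
  qed
  have zero_iff: "x = 0 \<longleftrightarrow> y = 0" if xy: "(x, y) \<in> ?p" for x y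
  proof -
    obtain S where S: "S \<subseteq> {..<n}" "x = comb v n S" "y = comb w n S" using xy by auto
    have "S \<in> fst (diagram n v) \<longleftrightarrow> S \<in> fst (diagram n w)" by (simp only: eq)
    then show ?thesis using S by (simp add: diagram_def)
  qed
  have cubes: "cube (generic (length zs)) (fst z) (map fst zs) =
       cube (generic (length zs)) (snd z) (map snd zs)" if z: "z \<in> ?p" "set zs \<subseteq> ?p" for z zs
  proof (cases "length zs \<le> 2 ^ n")
    case True
    obtain S where S: "S \<subseteq> {..<n}" "z = (comb v n S, comb w n S)" using z(1) by auto
    have "\<forall>z\<in>set zs. \<exists>S. S \<subseteq> {..<n} \<and> z = (comb v n S, comb w n S)" using z(2) by auto
    then obtain f where f: "\<And>z. z \<in> set zs \<Longrightarrow> f z \<subseteq> {..<n} \<and> z = (comb v n (f z), comb w n (f z))"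
      by metis
    define Ss where "Ss = map f zs"
    have m: "map fst zs = map (comb v n) Ss" "map snd zs = map (comb w n) Ss"
      unfolding Ss_def using f by (auto simp: prod_eq_iff)
    have "S # Ss \<in> snd (diagram n v) \<longleftrightarrow> S # Ss \<in> snd (diagram n w)" by (simp only: eq)
    moreover have "set Ss \<subseteq> Pow {..<n}" unfolding Ss_def using f by auto
    moreover have "length Ss = length zs" by (simp add: Ss_def)
    ultimately show ?thesis using S True by (simp add: diagram_def m)
  next
    case False
    then have card: "card (f ` ?p) \<le> length zs" for f :: "nat \<times> nat \<Rightarrow> nat"
      using card_image_le[OF fin, of f] card_p by linarith
    have "\<not> cube h c (map fst zs)" for h c
    proof (rule cube_vanishes[of "fst ` ?p"])
      show "x XOR y \<in> fst ` ?p" if xy: "x \<in> fst ` ?p" "y \<in> fst ` ?p" for x y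
      proof -
        obtain x' y' where "(x, x') \<in> ?p" "(y, y') \<in> ?p" using xy by force
        from add[OF this] show ?thesis by (rule image_eqI[rotated]) simp
      qed
      show "0 \<in> fst ` ?p" using zero by (rule image_eqI[rotated]) simp
      show "set (map fst zs) \<subseteq> fst ` ?p" using z(2) by auto
    qed (use fin card in auto)
    moreover have "\<not> cube h c (map snd zs)" for h c
    proof (rule cube_vanishes[of "snd ` ?p"])
      show "x XOR y \<in> snd ` ?p" if xy: "x \<in> snd ` ?p" "y \<in> snd ` ?p" for x y
      proof -
        obtain x' y' where "(x', x) \<in> ?p" "(y', y) \<in> ?p" using xy by force
        from add[OF this] show ?thesis by (rule image_eqI[rotated]) simp
      qed
      show "0 \<in> snd ` ?p" using zero by (rule image_eqI[rotated]) simp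
      show "set (map snd zs) \<subseteq> snd ` ?p" using z(2) by auto
    qed (use fin card in auto)
    ultimately show ?thesis by simp
  qed
  show ?thesis
    unfolding partial_iso_def
  proof (intro conjI allI impI fin zero)
    fix x y x' y' assume "(x, y) \<in> ?p \<and> (x', y') \<in> ?p"
    then show "(x XOR x', y XOR y') \<in> ?p" using add by simp
  next
    fix x y assume "(x, y) \<in> ?p"
    then show "x = 0 \<longleftrightarrow> y = 0" by (rule zero_iff)
  next
    fix z zs assume "z \<in> ?p \<and> set zs \<subseteq> ?p"
    then show "cube (generic (length zs)) (fst z) (map fst zs) =
       cube (generic (length zs)) (snd z) (map snd zs)" using cubes by simp
  qed
qed

theorem omega_categorical_cube_structure: "omega_categorical cube_language cube_structure"
proof (rule omega_categorical_if_finitely_many_types)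
  fix n
  have "ftype cube_language cube_structure n v = ftype cube_language cube_structure n w"
    if eq: "diagram n v = diagram n w" for v w
    unfolding ftype_eq_iff
  proof
    fix \<phi> assume "\<phi> \<in> formulas cube_language n"
    then have \<phi>: "wf_form cube_language \<phi>" "free_vars \<phi> \<subseteq> {..<n}" by (auto simp: formulas_def)
    have "(v i, w i) \<in> {(comb v n S, comb w n S) |S. S \<subseteq> {..<n}}" if "i < n" for i
      using that comb_singleton[OF that, of v] comb_singleton[OF that, of w] by force
    with \<phi>(2) show "sat cube_structure v \<phi> \<longleftrightarrow> sat cube_structure w \<phi>"
      by (intro partial_iso_sat[OF \<phi>(1) partial_iso_of_diagram[OF eq]]) blast
  qed
  then have "ftype cube_language cube_structure n v =
      ftype cube_language cube_structure n (inv_into UNIV (diagram n) (diagram n v))" for v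
    by (metis f_inv_into_f rangeI)
  then have "{ftype cube_language cube_structure n v |v. valuation cube_structure v} \<subseteq>
      (\<lambda>d. ftype cube_language cube_structure n (inv_into UNIV (diagram n) d)) ` range (diagram n)"
    by blast
  then show "finite {ftype cube_language cube_structure n v |v. valuation cube_structure v}"
    by (rule finite_subset) (simp add: finite_diagrams)
qed (simp_all add: fo_structure_cube_structure)


section \<open>Invariant functions for extremely amenable groups\<close>

text \<open>A flow on a set that embeds into \<open>nat set set\<close> is transported along the embedding to one of those
  that extreme amenability speaks of.\<close>

lemma fixed_point_if_extremely_amenable:
  fixes X :: "'x topology" and \<iota> :: "'x \<Rightarrow> nat set set"
  assumes ea: "extremely_amenable G T" and fl: "flow G T X \<phi>" and inj: "inj_on \<iota> (topspace X)"
  shows "\<exists>x\<in>topspace X. \<forall>g\<in>carrier G. \<phi> g x = x"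
proof -
  define E where "E = topspace X"
  define \<kappa> where "\<kappa> = inv_into E \<iota>"
  define Y where "Y = pullback_topology (\<iota> ` E) \<kappa> X"
  define \<psi> where "\<psi> g = (\<lambda>y\<in>\<iota> ` E. \<iota> (\<phi> g (\<kappa> y)))" for g
  interpret group_action G E \<phi> using fl by (simp add: flow_def E_def)
  have \<kappa>: "\<kappa> (\<iota> x) = x" if "x \<in> E" for x
    using that inj by (simp add: \<kappa>_def E_def)
  have topY: "topspace Y = \<iota> ` E"
    unfolding Y_def topspace_pullback_topology using \<kappa> by (auto simp: E_def)
  have contk: "continuous_map Y X \<kappa>"
    using continuous_map_pullback[OF continuous_map_id, of "\<iota> ` E" \<kappa> X] by (simp add: Y_def)
  have conti: "continuous_map X Y \<iota>"
    unfolding Y_def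
  proof (rule continuous_map_pullback')
    show "continuous_map X X (\<kappa> \<circ> \<iota>)"
      by (rule continuous_map_eq[OF continuous_map_id]) (use \<kappa> in \<open>simp add: E_def\<close>)
  qed (auto simp: E_def)
  have "homeomorphic_maps X Y \<iota> \<kappa>"
    unfolding homeomorphic_maps_def using conti contk \<kappa> topY by (auto simp: E_def)
  then have hom: "X homeomorphic_space Y" by (auto simp: homeomorphic_space_def)
  have act: "\<phi> g x \<in> E" if "g \<in> carrier G" "x \<in> E" for g x
    using that by (rule element_image) simp
  have \<psi>: "\<psi> g (\<iota> x) = \<iota> (\<phi> g x)" if "x \<in> E" for g x
    using that by (simp add: \<psi>_def \<kappa>)
  have inj': "inj_on \<iota> E" using inj by (simp add: E_def)
  have \<psi>_Bij: "\<psi> g \<in> Bij (\<iota> ` E)" if g: "g \<in> carrier G" for g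
  proof -
    have "inj_on (\<psi> g) (\<iota> ` E)"
    proof (rule inj_onI)
      fix y y' assume "y \<in> \<iota> ` E" "y' \<in> \<iota> ` E" and eq: "\<psi> g y = \<psi> g y'"
      then obtain x x' where x: "x \<in> E" "x' \<in> E" "y = \<iota> x" "y' = \<iota> x'" by blast
      with eq have "\<phi> g x = \<phi> g x'" using \<psi> inj_onD[OF inj'] act[OF g] by metis
      with x inj_prop[OF g] show "y = y'" by (auto dest: inj_onD)
    qed
    moreover have "\<psi> g ` \<iota> ` E = \<iota> ` E"
    proof -
      have "\<psi> g ` \<iota> ` E = \<iota> ` \<phi> g ` E" using \<psi> by (force simp: image_iff)
      then show ?thesis using surj_prop[OF g] by simp
    qed
    ultimately show ?thesis by (simp add: Bij_def bij_betw_def \<psi>_def)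
  qed
  have "group_action G (\<iota> ` E) \<psi>"
    unfolding group_action_def group_hom_def group_hom_axioms_def
  proof (intro conjI)
    show "Group.group G" using group_hom by (simp add: group_hom_def)
    show "Group.group (BijGroup (\<iota> ` E))" by (rule group_BijGroup)
    show "\<psi> \<in> hom G (BijGroup (\<iota> ` E))"
    proof (rule homI)
      fix g assume "g \<in> carrier G"
      then show "\<psi> g \<in> carrier (BijGroup (\<iota> ` E))" using \<psi>_Bij by (simp add: BijGroup_def)
    next
      fix g h assume g: "g \<in> carrier G" and h: "h \<in> carrier G"
      have "\<psi> (g \<otimes>\<^bsub>G\<^esub> h) = compose (\<iota> ` E) (\<psi> g) (\<psi> h)"
      proof (rule ext)
        fix y
        show "\<psi> (g \<otimes>\<^bsub>G\<^esub> h) y = compose (\<iota> ` E) (\<psi> g) (\<psi> h) y"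
        proof (cases "y \<in> \<iota> ` E")
          case True
          then obtain x where x: "x \<in> E" "y = \<iota> x" by blast
          then show ?thesis
            using composition_rule[OF x(1) g h] act[OF h] by (simp add: compose_def \<psi>)
        qed (simp add: \<psi>_def compose_def)
      qed
      then show "\<psi> (g \<otimes>\<^bsub>G\<^esub> h) = \<psi> g \<otimes>\<^bsub>BijGroup (\<iota> ` E)\<^esub> \<psi> h"
        using \<psi>_Bij[OF g] \<psi>_Bij[OF h] by (simp add: BijGroup_def)
    qed
  qed
  moreover have "continuous_map (prod_topology T Y) Y (\<lambda>(g, y). \<psi> g y)"
  proof -
    have "continuous_map (prod_topology T Y) (prod_topology T X) (\<lambda>(g, y). (g, \<kappa> y))"
      using contk by (simp add: continuous_map_prod_top)
    moreover have "continuous_map (prod_topology T X) X (\<lambda>(g, x). \<phi> g x)"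
      using fl by (simp add: flow_def)
    ultimately have "continuous_map (prod_topology T Y) Y
        (\<iota> \<circ> ((\<lambda>(g, x). \<phi> g x) \<circ> (\<lambda>(g, y). (g, \<kappa> y))))"
      using conti by (intro continuous_map_compose)
    then show ?thesis
      by (rule continuous_map_eq) (auto simp: topY \<psi>_def)
  qed
  moreover have "topspace Y \<noteq> {}" "compact_space Y" "Hausdorff_space Y"
    using fl homeomorphic_compact_space[OF hom] homeomorphic_Hausdorff_space[OF hom]
    by (auto simp: flow_def topY E_def)
  ultimately have "flow G T Y \<psi>" by (simp add: flow_def topY)
  with ea obtain y where y: "y \<in> topspace Y" "\<forall>g\<in>carrier G. \<psi> g y = y"
    unfolding extremely_amenable_def by blast
  then obtain x where x: "x \<in> E" "y = \<iota> x" unfolding topY by blast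
  have "\<phi> g x = x" if "g \<in> carrier G" for g
  proof -
    have "\<iota> (\<phi> g x) = \<iota> x" using y(2) that \<psi>[OF x(1)] x(2) by metis
    then show ?thesis using inj_onD[OF inj'] act[OF that x(1)] x(1) by blast
  qed
  with x(1) show ?thesis unfolding E_def by blast
qed

abbreviation cantor_topology :: "(nat \<Rightarrow> bool) topology" where
  "cantor_topology \<equiv> product_topology (\<lambda>_. discrete_topology UNIV) UNIV"

text \<open>The group acts on functions by \<open>g \<mapsto> g \<circ> h\<^sup>-\<^sup>1\<close>. This is continuous, because the value of the result at
  \<open>x\<close> depends on a single value of \<open>h\<^sup>-\<^sup>1\<close> and a single value of \<open>g\<close>.\<close>

lemma invariant_function_if_extremely_amenable:
  assumes ea: "extremely_amenable (perm_group (UNIV :: nat set) H) (pointwise_topology UNIV H)"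
    and H: "Group.group (perm_group (UNIV :: nat set) H)" "H \<subseteq> Bij UNIV"
    and W: "closedin cantor_topology W" "W \<noteq> {}"
    and inv: "\<And>h g. h \<in> H \<Longrightarrow> g \<in> W \<Longrightarrow> g \<circ> h \<in> W"
  shows "\<exists>g\<in>W. \<forall>h\<in>H. g \<circ> h = g"
proof -
  let ?G = "perm_group (UNIV :: nat set) H"
  interpret G: Group.group ?G by (rule H(1))
  have carrier: "carrier ?G = H" by (simp add: perm_group_def)
  have mult: "h \<otimes>\<^bsub>?G\<^esub> k = h \<circ> k" if "h \<in> H" "k \<in> H" for h k
    using that H(2) by (auto simp: perm_group_def BijGroup_def compose_def fun_eq_iff)
  have bij: "bij h" if "h \<in> H" for h using that H(2) by (auto simp: Bij_def)
  have one: "\<one>\<^bsub>?G\<^esub> = id" by (auto simp: perm_group_def BijGroup_def)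
  have inv_in: "inv_into UNIV h \<in> H" if h: "h \<in> H" for h
  proof -
    define k where "k = inv\<^bsub>?G\<^esub> h"
    have k: "k \<in> H" using G.inv_closed[of h] h by (simp add: carrier k_def)
    have "h \<circ> k = id" using G.r_inv[of h] h mult[OF h k] one by (simp add: carrier k_def)
    then have "h (k x) = x" for x by (metis comp_apply id_apply)
    then have "inv_into UNIV h x = k x" for x
      using bij[OF h] by (metis bij_inv_eq_iff)
    then have "inv_into UNIV h = k" by blast
    with k show ?thesis by simp
  qed
  define \<phi> where "\<phi> h = (\<lambda>g\<in>W. g \<circ> inv_into UNIV h)" for h :: "nat \<Rightarrow> nat"
  define X where "X = subtopology cantor_topology W"
  have topX: "topspace X = W" by (simp add: X_def)
  have \<phi>_in: "\<phi> h g \<in> W" if "h \<in> H" "g \<in> W" for h g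
    using that inv[OF inv_in] by (simp add: \<phi>_def)
  have \<phi>_comp: "\<phi> (h \<circ> k) g = \<phi> h (\<phi> k g)" if "h \<in> H" "k \<in> H" "g \<in> W" for h k g
  proof -
    have "inv_into UNIV (h \<circ> k) = inv_into UNIV k \<circ> inv_into UNIV h"
      using bij that by (simp add: o_inv_distrib)
    with that \<phi>_in[of k g] show ?thesis by (simp add: \<phi>_def comp_assoc)
  qed
  have \<phi>_Bij: "\<phi> h \<in> Bij W" if h: "h \<in> H" for h
  proof -
    have k: "inv_into UNIV h \<in> H" by (rule inv_in[OF h])
    have "h \<circ> inv_into UNIV h = id" "inv_into UNIV h \<circ> h = id"
      using bij[OF h] by (auto simp: fun_eq_iff bij_is_surj bij_is_inj surj_f_inv_f)
    then have "\<phi> (inv_into UNIV h) (\<phi> h g) = g" "\<phi> h (\<phi> (inv_into UNIV h) g) = g" if "g \<in> W" for g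
      using \<phi>_comp[OF h k that] \<phi>_comp[OF k h that] that by (simp_all add: \<phi>_def)
    then have "bij_betw (\<phi> h) W W"
      using \<phi>_in[OF h] \<phi>_in[OF k] by (intro bij_betw_byWitness[of _ "\<phi> (inv_into UNIV h)"]) auto
    then show ?thesis by (simp add: Bij_def \<phi>_def)
  qed
  have "group_action ?G W \<phi>"
    unfolding group_action_def group_hom_def group_hom_axioms_def
  proof (intro conjI)
    show "Group.group ?G" by (rule H(1))
    show "Group.group (BijGroup W)" by (rule group_BijGroup)
    show "\<phi> \<in> hom ?G (BijGroup W)"
    proof (rule homI)
      fix h assume "h \<in> carrier ?G"
      then show "\<phi> h \<in> carrier (BijGroup W)" using \<phi>_Bij by (simp add: carrier BijGroup_def)
    next
      fix h k assume "h \<in> carrier ?G" "k \<in> carrier ?G"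
      then have hk: "h \<in> H" "k \<in> H" by (simp_all add: carrier)
      have "\<phi> (h \<circ> k) = compose W (\<phi> h) (\<phi> k)"
      proof (rule ext)
        fix g show "\<phi> (h \<circ> k) g = compose W (\<phi> h) (\<phi> k) g"
          using \<phi>_comp[OF hk, of g] by (cases "g \<in> W") (simp_all add: compose_def, simp add: \<phi>_def)
      qed
      then show "\<phi> (h \<otimes>\<^bsub>?G\<^esub> k) = \<phi> h \<otimes>\<^bsub>BijGroup W\<^esub> \<phi> k"
        using hk \<phi>_Bij by (simp add: mult BijGroup_def)
    qed
  qed
  moreover have "continuous_map (prod_topology (pointwise_topology UNIV H) X) X (\<lambda>(h, g). \<phi> h g)"
    unfolding X_def continuous_map_in_subtopology
  proof (intro conjI)
    let ?P = "prod_topology (pointwise_topology UNIV H) (subtopology cantor_topology W)"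
    have topP: "topspace ?P = H \<times> W" by (simp add: pointwise_topology_def)
    then show "(\<lambda>(h, g). \<phi> h g) \<in> topspace ?P \<rightarrow> W" using \<phi>_in by auto
    show "continuous_map ?P cantor_topology (\<lambda>(h, g). \<phi> h g)"
      unfolding continuous_map_componentwise_UNIV
    proof
      fix x
      show "continuous_map ?P (discrete_topology UNIV) (\<lambda>q. (case q of (h, g) \<Rightarrow> \<phi> h g) x)"
        unfolding continuous_map_def
      proof (intro conjI allI impI)
        fix U :: "bool set"
        show "openin ?P {q \<in> topspace ?P. (case q of (h, g) \<Rightarrow> \<phi> h g) x \<in> U}"
        proof (subst openin_subopen, intro ballI)
          fix q assume q: "q \<in> {q \<in> topspace ?P. (case q of (h, g) \<Rightarrow> \<phi> h g) x \<in> U}"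
          then obtain h g where hg: "q = (h, g)" "h \<in> H" "g \<in> W" "\<phi> h g x \<in> U"
            unfolding topP by auto
          define y where "y = inv_into UNIV h x"
          have hy: "h y = x" unfolding y_def using bij[OF hg(2)] by (simp add: bij_is_surj surj_f_inv_f)
          define A where "A = {k \<in> H. k y = x}"
          define B where "B = {f \<in> W. f y = g y}"
          have A: "openin (pointwise_topology UNIV H) A"
          proof -
            have "continuous_map (pointwise_topology UNIV H) (discrete_topology UNIV) (\<lambda>k. k y)"
              unfolding pointwise_topology_def
              by (intro continuous_map_from_subtopology
                  continuous_map_product_projection[of y UNIV "\<lambda>_. discrete_topology UNIV"]) simp
            from openin_continuous_map_preimage[OF this, of "{x}"]
            show ?thesis by (simp add: A_def pointwise_topology_def)
          qed
          have B: "openin (subtopology cantor_topology W) B"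
          proof -
            have "continuous_map (subtopology cantor_topology W) (discrete_topology UNIV) (\<lambda>f. f y)"
              by (intro continuous_map_from_subtopology
                  continuous_map_product_projection[of y UNIV "\<lambda>_. discrete_topology UNIV"]) simp
            from openin_continuous_map_preimage[OF this, of "{g y}"]
            show ?thesis by (simp add: B_def)
          qed
          have "openin ?P (A \<times> B)" using A B by (simp add: openin_prod_Times_iff)
          moreover have "q \<in> A \<times> B" using hg hy by (simp add: A_def B_def)
          moreover have "A \<times> B \<subseteq> {q \<in> topspace ?P. (case q of (h, g) \<Rightarrow> \<phi> h g) x \<in> U}"
          proof
            fix q' assume "q' \<in> A \<times> B"
            then obtain k f where kf: "q' = (k, f)" "k \<in> H" "k y = x" "f \<in> W" "f y = g y"
              by (auto simp: A_def B_def)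
            have "inv_into UNIV k x = y" using bij[OF kf(2)] kf(3) by (metis bij_inv_eq_iff)
            then have "\<phi> k f x = \<phi> h g x" using kf hg by (simp add: \<phi>_def y_def)
            with hg kf show "q' \<in> {q \<in> topspace ?P. (case q of (h, g) \<Rightarrow> \<phi> h g) x \<in> U}"
              unfolding topP by simp
          qed
          ultimately show "\<exists>T. openin ?P T \<and> q \<in> T \<and>
              T \<subseteq> {q \<in> topspace ?P. (case q of (h, g) \<Rightarrow> \<phi> h g) x \<in> U}" by blast
        qed
      qed simp
    qed
  qed
  moreover have "compact_space X"
  proof -
    have "compact_space cantor_topology"
      by (simp add: compact_space_product_topology compact_space_discrete_topology)
    from closedin_compact_space[OF this W(1)] show ?thesis
      unfolding X_def by (rule compact_space_subtopology)
  qed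
  moreover have "Hausdorff_space X"
    unfolding X_def by (intro Hausdorff_space_subtopology) (simp add: Hausdorff_space_product_topology)
  ultimately have fl: "flow ?G (pointwise_topology UNIV H) X \<phi>"
    using W(2) by (simp add: flow_def topX)
  have "inj_on (\<lambda>g :: nat \<Rightarrow> bool. {{n} |n. g n}) (topspace X)"
  proof (rule inj_onI)
    fix f g :: "nat \<Rightarrow> bool" assume eq: "{{n} |n. f n} = {{n} |n. g n}"
    show "f = g"
    proof (rule ext)
      fix k
      have "{k} \<in> {{n} |n. f n} \<longleftrightarrow> {k} \<in> {{n} |n. g n}" by (simp only: eq)
      then show "f k = g k" by simp
    qed
  qed
  from fixed_point_if_extremely_amenable[OF ea fl this] obtain g where
    g: "g \<in> W" "\<And>h. h \<in> H \<Longrightarrow> \<phi> h g = g" unfolding topX carrier by blast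
  have "g \<circ> h = g" if h: "h \<in> H" for h
  proof -
    have "g \<circ> inv_into UNIV (inv_into UNIV h) = g"
      using g(2)[OF inv_in[OF h]] g(1) by (simp add: \<phi>_def)
    then show ?thesis using bij[OF h] by (simp add: inv_inv_eq)
  qed
  with g(1) show ?thesis by blast
qed

text \<open>An invariant function is determined by the set of orbits of diagonal pairs on which it is true, and
  finitely many orbits have finitely many sets of orbits.\<close>

lemma infinite_orbits_if_invariant_functions:
  fixes g :: "nat \<Rightarrow> nat \<Rightarrow> bool"
  assumes id: "id \<in> H" and inv: "\<And>n h. h \<in> H \<Longrightarrow> g n \<circ> h = g n" and inj: "inj g"
  shows "infinite (orbits_on_pairs UNIV H)"
proof
  assume fin: "finite (orbits_on_pairs UNIV H)"
  define orb where "orb x = (\<lambda>h. (h x, h x)) ` H" for x :: nat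
  have orb: "orb x \<in> orbits_on_pairs UNIV H" for x
    unfolding orbits_on_pairs_def orbits_def orbit_def orb_def
    by (auto simp: perm_group_def intro!: exI[of _ x])
  define \<Phi> where "\<Phi> n = {Q \<in> orbits_on_pairs UNIV H. \<exists>q\<in>Q. g n (fst q)}" for n
  have g: "g n x \<longleftrightarrow> orb x \<in> \<Phi> n" for n x
  proof -
    have "g n (h x) = g n x" if "h \<in> H" for h using inv[OF that, of n] by (metis comp_apply)
    moreover have "(x, x) \<in> orb x" unfolding orb_def using id by (auto intro: image_eqI[of _ _ id])
    ultimately show ?thesis using orb[of x] by (auto simp: \<Phi>_def orb_def)
  qed
  have "inj \<Phi>"
  proof (rule injI)
    fix n m assume "\<Phi> n = \<Phi> m"
    then have "g n = g m" using g by (intro ext) simp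
    with inj show "n = m" by (simp add: inj_eq)
  qed
  moreover have "finite (range \<Phi>)"
    by (rule finite_subset[of _ "Pow (orbits_on_pairs UNIV H)"]) (auto simp: \<Phi>_def fin)
  ultimately show False by (metis finite_imageD infinite_UNIV_nat)
qed

section \<open>Extremely amenable groups of automorphisms\<close>

text \<open>The coset of the \<open>n\<close>-th generic function modulo the polynomial functions of degree less than \<open>n\<close>.\<close>

definition cube_equivalent :: "nat \<Rightarrow> (nat \<Rightarrow> bool) set" where
  "cube_equivalent n = {g. \<forall>a xs. length xs = n \<longrightarrow> cube g a xs = cube (generic n) a xs}"

lemma closedin_cube_equivalent: "closedin cantor_topology (cube_equivalent n)"
proof -
  have cont: "continuous_map cantor_topology (discrete_topology UNIV) (\<lambda>g. cube g a xs)" for a xs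
  proof (induction xs arbitrary: a)
    case Nil
    show ?case
      using continuous_map_product_projection[of a UNIV "\<lambda>_. discrete_topology UNIV"] by simp
  next
    case (Cons x xs)
    have "continuous_map cantor_topology (prod_topology (discrete_topology UNIV) (discrete_topology UNIV))
        (\<lambda>g. (cube g a xs, cube g (a XOR x) xs))"
      using Cons by (simp add: continuous_map_pairwise comp_def)
    then have "continuous_map cantor_topology (discrete_topology UNIV)
        ((\<lambda>(b, c). b \<noteq> c) \<circ> (\<lambda>g. (cube g a xs, cube g (a XOR x) xs)))"
      by (rule continuous_map_compose) (simp add: prod_topology_discrete_topology[symmetric])
    then show ?case by (simp add: comp_def)
  qed
  have "closedin cantor_topology {g \<in> topspace cantor_topology. cube g a xs \<in> {cube (generic n) a xs}}" for a xs
    by (rule closedin_continuous_map_preimage[OF cont]) simp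
  then have "closedin cantor_topology (\<Inter>(a, xs)\<in>UNIV \<times> {xs. length xs = n}.
      {g. cube g a xs = cube (generic n) a xs})"
    by (intro closedin_INT) (auto intro: exI[of _ "replicate n 0"])
  moreover have "(\<Inter>(a, xs)\<in>UNIV \<times> {xs. length xs = n}. {g. cube g a xs = cube (generic n) a xs}) =
      cube_equivalent n"
    by (auto simp: cube_equivalent_def)
  ultimately show ?thesis by simp
qed

lemma generic_in_cube_equivalent: "generic n \<in> cube_equivalent n"
  by (simp add: cube_equivalent_def)

lemma cube_equivalent_invariant:
  assumes h: "h \<in> Aut cube_language cube_structure" and g: "g \<in> cube_equivalent n"
  shows "g \<circ> h \<in> cube_equivalent n"
proof -
  have iso: "rel_of cube_structure r xs \<longleftrightarrow> rel_of cube_structure r (map h xs)"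
    if "r \<in> rels cube_language" "length xs = snd r" for r xs
  proof -
    have "isomorphism cube_language cube_structure cube_structure h"
      using h by (simp add: Aut_def)
    moreover have "xs \<in> tuples (snd r) (Dom cube_structure)" using that(2) by (simp add: tuples_def)
    ultimately show ?thesis using that(1) unfolding isomorphism_def by blast
  qed
  have xor: "h (x XOR y) = h x XOR h y" for x y
    using iso[of "(1, 3)" "[x, y, x XOR y]"] by (simp add: cube_language_def cube_structure_def)
  have "cube (g \<circ> h) a xs = cube (generic n) a xs" if "length xs = n" for a xs
  proof -
    have "cube (g \<circ> h) a xs = cube g (h a) (map h xs)" by (rule cube_comp) (rule xor)
    also have "\<dots> = cube (generic n) (h a) (map h xs)" using g that by (simp add: cube_equivalent_def)
    also have "\<dots> = cube (generic n) a xs"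
      using iso[of "(0, Suc n)" "a # xs"] that by (simp add: cube_language_def cube_structure_def)
    finally show ?thesis .
  qed
  then show ?thesis by (simp add: cube_equivalent_def)
qed

lemma cube_equivalent_disjoint:
  assumes "n < m"
  shows "cube_equivalent n \<inter> cube_equivalent m = {}"
proof (rule ccontr)
  assume "\<not> ?thesis"
  then obtain g where g: "g \<in> cube_equivalent n" "g \<in> cube_equivalent m" by blast
  obtain a xs where xs: "length xs = m" "cube (generic n) a xs \<noteq> cube (generic m) a xs"
    using generic_cube_neq[of n m m] assms by auto
  have "cube g a xs = cube (generic n) a xs"
    by (rule cube_eq_longer[of n]) (use g(1) xs(1) assms in \<open>auto simp: cube_equivalent_def\<close>)
  moreover have "cube g a xs = cube (generic m) a xs"
    using g(2) xs(1) by (simp add: cube_equivalent_def)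
  ultimately show False using xs(2) by simp
qed

lemma infinite_orbits_if_extremely_amenable:
  assumes H: "subgroup H (perm_group UNIV (Aut cube_language cube_structure))"
    and ea: "extremely_amenable (perm_group UNIV H) (pointwise_topology UNIV H)"
  shows "infinite (orbits_on_pairs UNIV H)"
proof -
  let ?A = "Aut cube_language cube_structure"
  have "Group.group (perm_group UNIV ?A)"
    unfolding perm_group_def
    using subgroup.subgroup_is_group[OF subgroup_Aut[OF fo_structure_cube_structure] group_BijGroup]
    by simp
  from subgroup.subgroup_is_group[OF H this]
  have grp: "Group.group (perm_group UNIV H)" by (simp add: perm_group_def)
  have HA: "H \<subseteq> ?A" using subgroup.subset[OF H] by (simp add: perm_group_def)
  then have bij: "H \<subseteq> Bij UNIV" by (auto simp: Aut_def)
  have "\<exists>g\<in>cube_equivalent n. \<forall>h\<in>H. g \<circ> h = g" for n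
  proof (rule invariant_function_if_extremely_amenable[OF ea grp bij closedin_cube_equivalent])
    show "cube_equivalent n \<noteq> {}" using generic_in_cube_equivalent by blast
    show "g \<circ> h \<in> cube_equivalent n" if "h \<in> H" "g \<in> cube_equivalent n" for h g
      using cube_equivalent_invariant[of h g n] that HA by blast
  qed
  then obtain g where g: "\<And>n. g n \<in> cube_equivalent n" "\<And>n h. h \<in> H \<Longrightarrow> g n \<circ> h = g n"
    by metis
  have "inj g"
  proof (rule linorder_injI)
    fix n m :: nat assume "n < m"
    from cube_equivalent_disjoint[OF this] g(1)[of n] g(1)[of m] show "g n \<noteq> g m" by auto
  qed
  moreover have "id \<in> H"
  proof -
    have "(\<lambda>x\<in>UNIV. x) = (id :: nat \<Rightarrow> nat)" by auto
    then show ?thesis using subgroup.one_closed[OF H] by (simp add: perm_group_def BijGroup_def)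
  qed
  ultimately show ?thesis using infinite_orbits_if_invariant_functions[of H g] g(2) by blast
qed

lemma Aut_expansion_subset:
  assumes "expansion L M L' M'"
  shows "Aut L' M' \<subseteq> Aut L M"
proof
  fix h assume "h \<in> Aut L' M'"
  then have h: "h \<in> Bij (Dom M)" "isomorphism L' M' M' h"
    using assms by (auto simp: Aut_def expansion_def)
  have D: "Dom M' = Dom M" using assms by (simp add: expansion_def)
  have tup: "map h xs \<in> tuples n (Dom M)" if "xs \<in> tuples n (Dom M)" for n xs
    using that Bij_imp_funcset[OF h(1)] by (auto simp: tuples_def)
  have "isomorphism L M M h"
    unfolding isomorphism_def
  proof (intro conjI ballI)
    show "bij_betw h (Dom M) (Dom M)" using h(1) by (simp add: Bij_def)
  next
    fix f xs assume f: "f \<in> funs L" and xs: "xs \<in> tuples (snd f) (Dom M)"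
    have eq: "fun_of M f ys = fun_of M' f ys" if "ys \<in> tuples (snd f) (Dom M)" for ys
      using assms f that by (simp add: expansion_def)
    have "f \<in> funs L'" using assms f by (auto simp: expansion_def sublanguage_def)
    then show "h (fun_of M f xs) = fun_of M f (map h xs)"
      using h(2) xs unfolding eq[OF xs] eq[OF tup[OF xs]] by (simp add: isomorphism_def D)
  next
    fix r xs assume r: "r \<in> rels L" and xs: "xs \<in> tuples (snd r) (Dom M)"
    have eq: "rel_of M r ys = rel_of M' r ys" if "ys \<in> tuples (snd r) (Dom M)" for ys
      using assms r that by (simp add: expansion_def)
    have "r \<in> rels L'" using assms r by (auto simp: expansion_def sublanguage_def)
    then show "rel_of M r xs \<longleftrightarrow> rel_of M r (map h xs)"
      using h(2) xs unfolding eq[OF xs] eq[OF tup[OF xs]] by (simp add: isomorphism_def D)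
  qed
  with h(1) show "h \<in> Aut L M" by (simp add: Aut_def)
qed

theorem theorem1p2:
  shows "\<exists>(L :: name language) (M :: (name, nat) interp).
    countable_language L \<and> omega_categorical L M \<and>
    (\<forall>H. subgroup H (perm_group (Dom M) (Aut L M)) \<and>
         extremely_amenable (perm_group (Dom M) H) (pointwise_topology (Dom M) H) \<longrightarrow>
         infinite (orbits_on_pairs (Dom M) H)) \<and>
    \<not> (\<exists>(L' :: name language) (M' :: (name, nat) interp).
         countable_language L' \<and> expansion L M L' M' \<and> omega_categorical L' M' \<and>
         extremely_amenable (perm_group (Dom M') (Aut L' M'))
           (pointwise_topology (Dom M') (Aut L' M')))"
proof (intro exI conjI allI impI)
  show "countable_language cube_language" by (rule countable_cube_language)
  show "omega_categorical cube_language cube_structure" by (rule omega_categorical_cube_structure)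
  show "infinite (orbits_on_pairs (Dom cube_structure) H)"
    if "subgroup H (perm_group (Dom cube_structure) (Aut cube_language cube_structure)) \<and>
      extremely_amenable (perm_group (Dom cube_structure) H) (pointwise_topology (Dom cube_structure) H)" for H
    using that infinite_orbits_if_extremely_amenable by simp
  show "\<not> (\<exists>(L' :: name language) (M' :: (name, nat) interp).
         countable_language L' \<and> expansion cube_language cube_structure L' M' \<and> omega_categorical L' M' \<and>
         extremely_amenable (perm_group (Dom M') (Aut L' M'))
           (pointwise_topology (Dom M') (Aut L' M')))"
  proof
    assume "\<exists>(L' :: name language) (M' :: (name, nat) interp).
         countable_language L' \<and> expansion cube_language cube_structure L' M' \<and> omega_categorical L' M' \<and>
         extremely_amenable (perm_group (Dom M') (Aut L' M'))
           (pointwise_topology (Dom M') (Aut L' M'))"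
    then obtain L' :: "name language" and M' :: "(name, nat) interp" where
      L': "countable_language L'" and M': "expansion cube_language cube_structure L' M'"
        "omega_categorical L' M'"
      and ea: "extremely_amenable (perm_group (Dom M') (Aut L' M'))
           (pointwise_topology (Dom M') (Aut L' M'))" by blast
    have D: "Dom M' = UNIV" using M'(1) by (simp add: expansion_def)
    have "fo_structure L' M'" using M'(1) by (simp add: expansion_def)
    from subgroup_Aut[OF this] have sub: "subgroup (Aut L' M') (BijGroup UNIV)" by (simp add: D)
    have "subgroup (Aut L' M') (perm_group UNIV (Aut cube_language cube_structure))"
      unfolding perm_group_def
      by (rule group.subgroup_incl[OF group_BijGroup sub _ Aut_expansion_subset[OF M'(1)]])
        (use subgroup_Aut[OF fo_structure_cube_structure] in simp)
    then have "infinite (orbits_on_pairs UNIV (Aut L' M'))"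
      by (rule infinite_orbits_if_extremely_amenable) (use ea in \<open>simp add: D\<close>)
    with finitely_many_orbits_if_omega_categorical[OF L' M'(2)] show False by (simp add: D)
  qed
qed

end
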